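(* Let $A\in\mathbb{P}(2n)$ and let $1\le j\le n$ be such that the symplectic eigenvalue $d_j(A)$ is simple. Then there exists a neighbourhood $U$ of $A$ in $\mathbb{P}(2n)$ such that for every $P\in U$ the symplectic eigenvalue $d_j(P)$ of $P$ is simple, and the map $P\mapsto d_j(P)$ is infinitely differentiable on $U$. Further, if $(u_0,v_0)$ is a normalised symplectic eigenvector pair of $A$ corresponding to $d_j(A)$, then there exist infinitely differentiable maps $u_j,v_j:U\to\mathbb{R}^{2n}$ such that for every $P\in U$ the pair $(u_j(P),v_j(P))$ is a normalised symplectic eigenvector pair of $P$ corresponding to $d_j(P)$, $u_j(A)=u_0$, $v_j(A)=v_0$, and $$\langle u_0,Ju_j(P)\rangle+\langle v_0,Jv_j(P)\rangle=0\quad\text{for all }P\in U.$$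
   Context: Let $J=\begin{bmatrix}O & I_n\\ -I_n & O\end{bmatrix}$ ($2n\times 2n$). A real $2n\times 2n$ matrix $M$ is symplectic if $M^TJM=J$. $\mathbb{P}(2n)$ denotes the set of $2n\times 2n$ real symmetric positive definite matrices (an open subset of the space of real symmetric matrices). By Williamson's theorem, for every $A\in\mathbb{P}(2n)$ there is a symplectic $M$ with $M^TAM=\begin{bmatrix}D&O\\O&D\end{bmatrix}$, $D=\mathrm{diag}(d_1(A),\dots,d_n(A))$, where the numbers $0<d_1(A)\le\dots\le d_n(A)$ are uniquely determined by $A$; they are the symplectic eigenvalues of $A$ (always listed in increasing order). A symplectic eigenvalue $d$ of $A$ has multiplicity $m$ if $\{i: d_i(A)=d\}$ has exactly $m$ elements, and is simple if $m=1$. $\langle\cdot,\cdot\rangle$ is the Euclidean inner product. A pair $(u,v)$ of vectors in $\mathbb{R}^{2n}$ is a symplectic eigenvector pair of $A$ corresponding to the symplectic eigenvalue $d$ if $Au=dJv$ and $Av=-dJu$; it is normalised if $\langle u,Jv\rangle=1$. *)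

theory Defs
  imports "HOL-Analysis.Analysis"
begin

text \<open>The index set \<open>{1, ..., n}\<close> is rendered as an arbitrary finite linearly ordered
  type \<open>'n\<close>, and \<open>{1, ..., 2n}\<close> as \<open>'n + 'n\<close>: the summand \<open>Inl\<close> indexes the first \<open>n\<close>
  coordinates and \<open>Inr\<close> the last \<open>n\<close>. The order on \<open>'n\<close> is used only to list the symplectic
  eigenvalues increasingly.\<close>

definition block_matrix ::
  "real^'n^'n \<Rightarrow> real^'n^'n \<Rightarrow> real^'n^'n \<Rightarrow> real^'n^'n \<Rightarrow> real^('n + 'n)^('n::finite + 'n)" where
  "block_matrix A B C D = (\<chi> r c.
     (case r of
        Inl i \<Rightarrow> (case c of Inl j \<Rightarrow> A $ i $ j | Inr j \<Rightarrow> B $ i $ j)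
      | Inr i \<Rightarrow> (case c of Inl j \<Rightarrow> C $ i $ j | Inr j \<Rightarrow> D $ i $ j)))"

definition diag_matrix :: "('n \<Rightarrow> real) \<Rightarrow> real^'n^'n" where
  "diag_matrix d = (\<chi> i j. if i = j then d i else 0)"

definition J_matrix :: "real^('n + 'n)^('n::finite + 'n)" where
  "J_matrix = block_matrix 0 (mat 1) (- mat 1) 0"

definition symplectic :: "real^('n + 'n)^('n::finite + 'n) \<Rightarrow> bool" where
  "symplectic M \<longleftrightarrow> transpose M ** J_matrix ** M = J_matrix"

definition symmetric_matrices :: "(real^'k^'k) set" where
  "symmetric_matrices = {A. transpose A = A}"

definition posdef_matrices :: "(real^'k^'k) set" where
  "posdef_matrices = {A \<in> symmetric_matrices. \<forall>x. x \<noteq> 0 \<longrightarrow> 0 < x \<bullet> (A *v x)}"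

text \<open>By Williamson's theorem, the description below has exactly one solution \<open>d\<close> when \<open>A\<close>
  is positive definite; for other \<open>A\<close> the value is irrelevant.\<close>

definition symplectic_eigenvalue ::
  "real^('n + 'n)^('n + 'n) \<Rightarrow> 'n::{finite,linorder} \<Rightarrow> real" where
  "symplectic_eigenvalue A = (THE d. mono d \<and> (\<forall>i. 0 < d i) \<and>
     (\<exists>M. symplectic M \<and>
        transpose M ** A ** M = block_matrix (diag_matrix d) 0 0 (diag_matrix d)))"

definition symplectic_multiplicity :: "real^('n + 'n)^('n::{finite,linorder} + 'n) \<Rightarrow> real \<Rightarrow> nat" where
  "symplectic_multiplicity A d = card {i. symplectic_eigenvalue A i = d}"

definition simple_symplectic_eigenvalue ::
  "real^('n + 'n)^('n::{finite,linorder} + 'n) \<Rightarrow> real \<Rightarrow> bool" where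
  "simple_symplectic_eigenvalue A d \<longleftrightarrow> symplectic_multiplicity A d = 1"

definition symplectic_eigenvector_pair ::
  "real^('n + 'n)^('n::finite + 'n) \<Rightarrow> real \<Rightarrow> real^('n + 'n) \<Rightarrow> real^('n + 'n) \<Rightarrow> bool" where
  "symplectic_eigenvector_pair A d u v \<longleftrightarrow>
     A *v u = d *\<^sub>R (J_matrix *v v) \<and> A *v v = - d *\<^sub>R (J_matrix *v u)"

definition normalised_symplectic_eigenvector_pair ::
  "real^('n + 'n)^('n::finite + 'n) \<Rightarrow> real \<Rightarrow> real^('n + 'n) \<Rightarrow> real^('n + 'n) \<Rightarrow> bool" where
  "normalised_symplectic_eigenvector_pair A d u v \<longleftrightarrow>
     symplectic_eigenvector_pair A d u v \<and> u \<bullet> (J_matrix *v v) = 1"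

text \<open>Differentiability classes of \<open>f : U \<rightarrow> 'b\<close>, where \<open>U\<close> is a relatively open subset of a
  linear subspace \<open>V\<close> of a Euclidean space. The Frechet derivative of \<open>f\<close> as a map on the
  space \<open>V\<close> is the restriction to \<open>V\<close> of any derivative within \<open>U\<close>; this restriction
  is unique, and only it enters the recursion. As \<open>V\<close> is finite-dimensional, the derivative
  is of class \<open>C^k\<close> as an operator-valued map iff all its evaluations at vectors of \<open>V\<close> are.\<close>

primrec Ck_on ::
  "'a set \<Rightarrow> nat \<Rightarrow> 'a set \<Rightarrow> ('a::euclidean_space \<Rightarrow> 'b::real_normed_vector) \<Rightarrow> bool" where
  "Ck_on V 0 U f \<longleftrightarrow> continuous_on U f"
| "Ck_on V (Suc k) U f \<longleftrightarrow>
     (\<exists>f'. (\<forall>x\<in>U. (f has_derivative f' x) (at x within U)) \<and>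
           (\<forall>h\<in>V. Ck_on V k U (\<lambda>x. f' x h)))"

definition smooth_on ::
  "'a set \<Rightarrow> 'a set \<Rightarrow> ('a::euclidean_space \<Rightarrow> 'b::real_normed_vector) \<Rightarrow> bool" where
  "smooth_on V U f \<longleftrightarrow> (\<forall>k. Ck_on V k U f)"

end

theory Submission
  imports Defs
begin

text \<open>The diagonalising matrices of a convergent sequence in Williamson's theorem stay bounded, so
  compactness and uniqueness make every \<open>d\<^sub>i\<close> continuous, and simplicity of \<open>d\<^sub>j\<close> is an open
  condition. For a simple eigenvalue the equations \<open>Pu = dJv\<close>, \<open>Pv = -dJu\<close> together with the
  normalisation and the phase condition are, up to a scalar, a linear system with an invertible
  bordered matrix depending polynomially on \<open>P\<close> and \<open>d\<close>; by Cramer's rule \<open>u\<close> and \<open>v\<close> are as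
  smooth as \<open>d\<close>. An exact difference formula shows that \<open>d\<close> has derivative
  \<open>h \<mapsto> (u \<bullet> hu + v \<bullet> hv) / 2\<close>, which is again as smooth as \<open>d\<close>, and induction on the order of
  smoothness closes the loop. Since the normalised pairs of \<open>A\<close> are rotations of each other,
  the neighbourhood and the maps obtained for one pair serve for all of them.\<close>

section \<open>Calculus of \<open>C\<^sup>k\<close> functions\<close>

text \<open>With \<open>w = u + iv\<close> a symplectic eigenvector pair is a solution of
  \<open>A w = d (-iJ) w\<close>, an eigenvalue problem for two Hermitian matrices. Rotating a pair
  is multiplying \<open>w\<close> by a complex number \<open>a + ib\<close>, and the normalisation
  reads \<open>w* (-iJ) w = 2\<close>, which is the origin of the factors 2 and 1/2 below. The
  obstacle is that the normalised pairs of a simple eigenvalue still form a circle, so nothing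
  singles out a continuous choice. The phase condition says that \<open>w0* (-iJ) w\<close> is real,
  which leaves an ambiguity of sign; asking for a positive value removes it. Since the normalisation
  is quadratic in \<open>w\<close>, the linear system asks for \<open>w0* (-iJ) w = 1\<close>
  instead, and a positive square root rescales its solution afterwards. The derivative of
  \<open>d\<close> in direction \<open>h\<close> is \<open>w* h w\<close> divided by
  \<open>w* (-iJ) w\<close>, as in first-order perturbation theory. It contains the eigenvectors but
  not their derivatives, and this is why each turn of the loop gains one order.\<close>

lemma Ck_on_cong:
  assumes "Ck_on V k U f" "\<And>x. x \<in> U \<Longrightarrow> f x = g x"
  shows "Ck_on V k U g"
proof (cases k)
  case 0
  then show ?thesis using assms by (simp cong: continuous_on_cong)
next
  case (Suc m)
  then obtain f' where "\<forall>x\<in>U. (f has_derivative f' x) (at x within U)"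
    "\<forall>h\<in>V. Ck_on V m U (\<lambda>x. f' x h)"
    using assms(1) by auto
  moreover have "(g has_derivative f' x) (at x within U)"
    if "x \<in> U" "(f has_derivative f' x) (at x within U)" for x
    using has_derivative_transform[OF that(1) _ that(2), of g] assms(2) by simp
  ultimately show ?thesis using Suc by auto
qed

lemma Ck_on_const: "Ck_on V k U (\<lambda>x. c)"
proof (induction k arbitrary: c)
  case (Suc k)
  have "((\<lambda>x. c) has_derivative (\<lambda>h. 0)) (at x within U)" for x
    by (rule has_derivative_const)
  then show ?case using Suc by (auto intro!: exI[of _ "\<lambda>x h. 0"])
qed simp

text \<open>The rules for products, reciprocals and square roots at order \<open>Suc k\<close>
  involve the functions themselves beside their derivatives, so these must be available at order
  \<open>k\<close>.\<close>

lemma Ck_on_Suc_imp: "Ck_on V (Suc k) U f \<Longrightarrow> Ck_on V k U f"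
proof (induction k arbitrary: f)
  case 0
  then show ?case by (auto intro: has_derivative_continuous_on)
next
  case (Suc k)
  then obtain f' where "\<forall>x\<in>U. (f has_derivative f' x) (at x within U)"
    "\<forall>h\<in>V. Ck_on V (Suc k) U (\<lambda>x. f' x h)"
    by (auto simp only: Ck_on.simps(2)[of V "Suc k"])
  then show ?case using Suc.IH by auto
qed

lemma Ck_on_bounded_linear:
  assumes "bounded_linear f"
  shows "Ck_on V k U f"
proof (cases k)
  case 0
  then show ?thesis using assms by (simp add: linear_continuous_on)
next
  case (Suc m)
  have "(f has_derivative f) (at x within U)" for x
    using assms by (rule bounded_linear_imp_has_derivative)
  then show ?thesis using Suc by (auto intro!: exI[of _ "\<lambda>x. f"] Ck_on_const)
qed

lemma Ck_on_bounded_linear_compose: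
  assumes "bounded_linear T" "Ck_on V k U f"
  shows "Ck_on V k U (\<lambda>x. T (f x))"
  using assms(2)
proof (induction k arbitrary: f)
  case 0
  then show ?case using assms(1) by (simp add: bounded_linear.continuous_on)
next
  case (Suc k)
  then obtain f' where "\<forall>x\<in>U. (f has_derivative f' x) (at x within U)"
    "\<forall>h\<in>V. Ck_on V k U (\<lambda>x. f' x h)"
    by auto
  then show ?case using Suc.IH
    by (auto intro!: exI[of _ "\<lambda>x h. T (f' x h)"] bounded_linear.has_derivative[OF assms(1)])
qed

lemma Ck_on_add:
  assumes "Ck_on V k U f" "Ck_on V k U g"
  shows "Ck_on V k U (\<lambda>x. f x + g x)"
  using assms
proof (induction k arbitrary: f g)
  case 0
  then show ?case by (simp add: continuous_on_add)
next
  case (Suc k)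
  then obtain f' g' where "\<forall>x\<in>U. (f has_derivative f' x) (at x within U)"
    "\<forall>h\<in>V. Ck_on V k U (\<lambda>x. f' x h)"
    "\<forall>x\<in>U. (g has_derivative g' x) (at x within U)"
    "\<forall>h\<in>V. Ck_on V k U (\<lambda>x. g' x h)"
    by auto
  then show ?case using Suc.IH
    by (auto intro!: exI[of _ "\<lambda>x h. f' x h + g' x h"] has_derivative_add)
qed

lemma Ck_on_sum:
  assumes "\<And>i. i \<in> I \<Longrightarrow> Ck_on V k U (f i)"
  shows "Ck_on V k U (\<lambda>x. \<Sum>i\<in>I. f i x)"
  using assms by (induction I rule: infinite_finite_induct) (auto intro: Ck_on_const Ck_on_add)

lemma Ck_on_mult:
  fixes f g :: "'a::euclidean_space \<Rightarrow> real"
  assumes "Ck_on V k U f" "Ck_on V k U g"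
  shows "Ck_on V k U (\<lambda>x. f x * g x)"
  using assms
proof (induction k arbitrary: f g)
  case 0
  then show ?case by (simp add: continuous_on_mult)
next
  case (Suc k)
  have *: "Ck_on V k U f" "Ck_on V k U g" using Suc.prems Ck_on_Suc_imp by blast+
  from Suc.prems obtain f' g' where "\<forall>x\<in>U. (f has_derivative f' x) (at x within U)"
    "\<forall>h\<in>V. Ck_on V k U (\<lambda>x. f' x h)"
    "\<forall>x\<in>U. (g has_derivative g' x) (at x within U)"
    "\<forall>h\<in>V. Ck_on V k U (\<lambda>x. g' x h)"
    by auto
  then show ?case using Suc.IH *
    by (auto intro!: exI[of _ "\<lambda>x h. f x * g' x h + f' x h * g x"] has_derivative_mult Ck_on_add)
qed

lemma Ck_on_prod:
  fixes f :: "'i \<Rightarrow> 'a::euclidean_space \<Rightarrow> real"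
  assumes "\<And>i. i \<in> I \<Longrightarrow> Ck_on V k U (f i)"
  shows "Ck_on V k U (\<lambda>x. \<Prod>i\<in>I. f i x)"
  using assms by (induction I rule: infinite_finite_induct) (auto intro: Ck_on_const Ck_on_mult)

text \<open>The derivative of \<open>1/f\<close> is a polynomial in \<open>1/f\<close> and the
  derivative of \<open>f\<close>, so the induction hypothesis for \<open>1/f\<close> itself supplies
  the smoothness of its derivative. The square root follows the same pattern.\<close>

lemma Ck_on_inverse:
  fixes f :: "'a::euclidean_space \<Rightarrow> real"
  assumes "Ck_on V k U f" "\<And>x. x \<in> U \<Longrightarrow> f x \<noteq> 0"
  shows "Ck_on V k U (\<lambda>x. inverse (f x))"
  using assms(1)
proof (induction k)
  case 0
  then show ?case using assms(2) by (simp add: continuous_on_inverse)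
next
  case (Suc k)
  have inv: "Ck_on V k U (\<lambda>x. inverse (f x))" using Suc Ck_on_Suc_imp by blast
  from Suc.prems obtain f' where "\<forall>x\<in>U. (f has_derivative f' x) (at x within U)"
    "\<forall>h\<in>V. Ck_on V k U (\<lambda>x. f' x h)"
    by auto
  then show ?case using assms(2) inv
    by (auto intro!: exI[of _ "\<lambda>x h. - (inverse (f x) * f' x h * inverse (f x))"]
        has_derivative_inverse Ck_on_mult
        Ck_on_bounded_linear_compose[OF bounded_linear_minus[OF bounded_linear_ident]])
qed

lemma Ck_on_divide:
  fixes f g :: "'a::euclidean_space \<Rightarrow> real"
  assumes "Ck_on V k U f" "Ck_on V k U g" "\<And>x. x \<in> U \<Longrightarrow> g x \<noteq> 0"
  shows "Ck_on V k U (\<lambda>x. f x / g x)"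
  unfolding divide_inverse using assms by (intro Ck_on_mult Ck_on_inverse)

lemma Ck_on_sqrt:
  fixes f :: "'a::euclidean_space \<Rightarrow> real"
  assumes "Ck_on V k U f" "\<And>x. x \<in> U \<Longrightarrow> 0 < f x"
  shows "Ck_on V k U (\<lambda>x. sqrt (f x))"
  using assms(1)
proof (induction k)
  case 0
  then show ?case by (simp add: continuous_on_real_sqrt)
next
  case (Suc k)
  have s: "Ck_on V k U (\<lambda>x. sqrt (f x))" using Suc Ck_on_Suc_imp by blast
  from Suc.prems obtain f' where f': "\<forall>x\<in>U. (f has_derivative f' x) (at x within U)"
    "\<forall>h\<in>V. Ck_on V k U (\<lambda>x. f' x h)"
    by auto
  have "((\<lambda>x. sqrt (f x)) has_derivative (\<lambda>h. f' x h * (inverse (sqrt (f x)) / 2)))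
      (at x within U)" if "x \<in> U" for x
    using has_derivative_real_sqrt[of f, OF assms(2)[OF that]] f'(1) that by blast
  moreover have "Ck_on V k U (\<lambda>x. f' x h * (inverse (sqrt (f x)) / 2))" if "h \<in> V" for h
    using f'(2) that s assms(2)
    by (intro Ck_on_mult Ck_on_divide Ck_on_inverse Ck_on_const) force+
  ultimately show ?case by (auto intro!: exI[of _ "\<lambda>x h. f' x h * (inverse (sqrt (f x)) / 2)"])
qed

lemma Ck_on_component:
  assumes "Ck_on V k U f"
  shows "Ck_on V k U (\<lambda>x. f x $ i)"
  using Ck_on_bounded_linear_compose[OF bounded_linear_vec_nth assms] .

lemma bounded_linear_axis: "bounded_linear (axis i :: 'b::real_normed_vector \<Rightarrow> 'b^'k)"
proof (rule bounded_linear_intro)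
  show "norm (axis i x :: 'b^'k) \<le> norm x * 1" for x
    unfolding norm_vec_def[of "axis i x"]
    by (rule order_trans[OF L2_set_le_sum]) (simp_all add: axis_def if_distrib cong: if_cong)
qed (auto simp: axis_def vec_eq_iff)

lemma Ck_on_vec:
  fixes f :: "'a::euclidean_space \<Rightarrow> 'b::real_normed_vector^'k"
  assumes "\<And>i. Ck_on V k U (\<lambda>x. f x $ i)"
  shows "Ck_on V k U f"
proof -
  have "Ck_on V k U (\<lambda>x. \<Sum>i\<in>UNIV. axis i (f x $ i))"
    by (intro Ck_on_sum Ck_on_bounded_linear_compose[OF bounded_linear_axis] assms)
  then show ?thesis
    by (rule Ck_on_cong) (simp add: vec_eq_iff axis_def)
qed

lemma Ck_on_det:
  fixes M :: "'a::euclidean_space \<Rightarrow> real^'k^'k"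
  assumes "\<And>i j. Ck_on V k U (\<lambda>x. M x $ i $ j)"
  shows "Ck_on V k U (\<lambda>x. det (M x))"
  unfolding det_def by (intro Ck_on_sum Ck_on_mult Ck_on_prod Ck_on_const assms)

lemma Ck_on_inner:
  fixes f g :: "'a::euclidean_space \<Rightarrow> real^'k"
  assumes "Ck_on V k U f" "Ck_on V k U g"
  shows "Ck_on V k U (\<lambda>x. f x \<bullet> g x)"
  unfolding inner_vec_def inner_real_def
  by (intro Ck_on_sum Ck_on_mult Ck_on_component assms)

section \<open>Linear systems with parameters, and derivatives from difference formulas\<close>

definition cramer_solution :: "real^'k^'k \<Rightarrow> real^'k \<Rightarrow> real^'k" where
  "cramer_solution M b = (\<chi> k. det (\<chi> i j. if j = k then b $ i else M $ i $ j) / det M)"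

lemma cramer_solution_iff: "det M \<noteq> 0 \<Longrightarrow> M *v x = b \<longleftrightarrow> x = cramer_solution M b"
  unfolding cramer_solution_def by (rule cramer)

lemma Ck_on_cramer_solution:
  fixes M :: "'a::euclidean_space \<Rightarrow> real^'k^'k"
  assumes "\<And>i j. Ck_on V k U (\<lambda>x. M x $ i $ j)" "\<And>x. x \<in> U \<Longrightarrow> det (M x) \<noteq> 0"
  shows "Ck_on V k U (\<lambda>x. cramer_solution (M x) b)"
proof (rule Ck_on_vec)
  fix l
  have "Ck_on V k U (\<lambda>x. (\<chi> i j. if j = l then b $ i else M x $ i $ j) $ i $ j)" for i j
    by (cases "j = l") (simp_all add: Ck_on_const assms(1))
  then show "Ck_on V k U (\<lambda>x. cramer_solution (M x) b $ l)"
    unfolding cramer_solution_def using assms by (auto intro!: Ck_on_divide Ck_on_det)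
qed

text \<open>Caratheodory's form of differentiability: the error of the linear approximation is
  \<open>(g x - g a) \<bullet> (x - a)\<close>, which Cauchy-Schwarz bounds by
  \<open>norm (g x - g a) * norm (x - a)\<close>.\<close>

lemma has_derivative_slope_factor:
  fixes f :: "'a::euclidean_space \<Rightarrow> real"
  assumes "\<forall>\<^sub>F x in at a within U. f x - f a = g x \<bullet> (x - a)"
    and "(g \<longlongrightarrow> g a) (at a within U)"
  shows "(f has_derivative (\<lambda>h. g a \<bullet> h)) (at a within U)"
  unfolding has_derivative_within
proof
  show "bounded_linear ((\<bullet>) (g a))" by (rule bounded_linear_inner_right)
  have "((\<lambda>x. norm (g x - g a)) \<longlongrightarrow> 0) (at a within U)"
    using assms(2) by (auto simp: LIM_zero tendsto_norm_zero)
  moreover have "\<forall>\<^sub>F x in at a within U.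
     norm ((1 / norm (x - a)) *\<^sub>R (f x - (f a + g a \<bullet> (x - a)))) \<le> norm (g x - g a)"
    using assms(1)
  proof eventually_elim
    case (elim x)
    then have "f x - (f a + g a \<bullet> (x - a)) = (g x - g a) \<bullet> (x - a)"
      by (simp add: inner_diff_left)
    then show ?case
      using Cauchy_Schwarz_ineq2[of "g x - g a" "x - a"]
      by (cases "x = a") (simp_all add: divide_simps)
  qed
  ultimately show "((\<lambda>x. (1 / norm (x - a)) *\<^sub>R (f x - (f a + g a \<bullet> (x - a)))) \<longlongrightarrow> 0) (at a within U)"
    by (rule Lim_null_comparison[rotated])
qed

section \<open>Williamson's theorem\<close>

lemma sum_UNIV_Plus:
  fixes f :: "'a::finite + 'b::finite \<Rightarrow> 'c::comm_monoid_add"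
  shows "sum f UNIV = (\<Sum>i\<in>UNIV. f (Inl i)) + (\<Sum>i\<in>UNIV. f (Inr i))"
  by (simp flip: UNIV_Plus_UNIV add: sum.Plus)

lemma J_matrix_entry:
  "J_matrix $ Inl i $ Inl k = 0" "J_matrix $ Inl i $ Inr k = (if i = k then 1 else 0)"
  "J_matrix $ Inr i $ Inl k = (if i = k then -1 else 0)" "J_matrix $ Inr i $ Inr k = 0"
  by (simp_all add: J_matrix_def block_matrix_def mat_def)

lemma J_matrix_nth:
  "(J_matrix *v x) $ Inl i = x $ Inr i" "(J_matrix *v x) $ Inr i = - x $ Inl i"
  by (simp_all add: J_matrix_entry matrix_vector_mult_def sum_UNIV_Plus
      if_distrib if_distribR sum_negf cong: if_cong)

lemma matrix_vector_mult_uminus [simp]: "A *v (- x) = - (A *v (x :: 'a::field^'m))"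
  by (rule vec.neg)

lemma matrix_uminus_vector_mult [simp]: "(- A) *v x = - (A *v (x :: 'a::field^'m))"
  by (simp add: matrix_vector_mult_def vec_eq_iff sum_negf)

lemma J_matrix_J_matrix [simp]: "J_matrix *v (J_matrix *v x) = - x"
proof -
  have "(J_matrix *v (J_matrix *v x)) $ k = (- x) $ k" for k
    by (cases k) (simp_all add: J_matrix_nth)
  then show ?thesis by (simp add: vec_eq_iff)
qed

lemma inner_J_matrix_left: "(J_matrix *v x) \<bullet> y = - (x \<bullet> (J_matrix *v y))"
  by (simp add: inner_vec_def sum_UNIV_Plus J_matrix_nth sum_negf)

lemma J_matrix_skew: "x \<bullet> (J_matrix *v y) = - (y \<bullet> (J_matrix *v x))"
  by (metis inner_J_matrix_left inner_commute)

lemma J_matrix_alt [simp]: "x \<bullet> (J_matrix *v x) = 0"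
  using J_matrix_skew[of x x] by simp

lemma inner_J_J: "(J_matrix *v x) \<bullet> (J_matrix *v y) = x \<bullet> y"
  by (simp add: inner_J_matrix_left)

lemma matrix_mul_neg_left: "(- A) ** B = - (A ** (B :: real^'k^'m))"
  by (simp add: matrix_matrix_mult_def vec_eq_iff sum_negf)

lemma J_matrix_square: "J_matrix ** J_matrix = - mat 1"
  by (simp add: matrix_eq flip: matrix_vector_mul_assoc)

section \<open>Uniqueness of the symplectic eigenvalues\<close>

definition double_diag :: "('n::finite \<Rightarrow> real) \<Rightarrow> real^('n + 'n)^('n + 'n)" where
  "double_diag d = block_matrix (diag_matrix d) 0 0 (diag_matrix d)"

lemma double_diag_nth: "double_diag d $ k $ l = (if k = l then case_sum d d k else 0)"
  by (cases k; cases l) (auto simp: double_diag_def block_matrix_def diag_matrix_def)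

lemma double_diag_mult_nth: "(double_diag d *v x) $ k = case_sum d d k * x $ k"
  by (simp add: matrix_vector_mult_def double_diag_nth if_distrib if_distribR cong: if_cong)

lemma inner_transpose_mul:
  fixes A :: "real^'k^'k" and M :: "real^'m^'k"
  shows "x \<bullet> ((transpose M ** A ** M) *v y) = (M *v x) \<bullet> (A *v (M *v y))"
proof -
  have "x \<bullet> ((transpose M ** A ** M) *v y) = x \<bullet> (transpose M *v (A *v (M *v y)))"
    by (simp only: matrix_vector_mul_assoc matrix_mul_assoc)
  also have "\<dots> = (M *v x) \<bullet> (A *v (M *v y))"
    by (metis dot_lmul_matrix vector_transpose_matrix)
  finally show ?thesis .
qed

lemma transpose_mul_nth:
  fixes A :: "real^'k^'k" and M :: "real^'m^'k"
  shows "(transpose M ** A ** M) $ k $ l = column k M \<bullet> (A *v column l M)"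
proof -
  have "(transpose M ** A ** M) $ k $ l = axis k 1 \<bullet> ((transpose M ** A ** M) *v axis l 1)"
    by (simp add: matrix_vector_mult_basis inner_axis' column_def)
  also have "\<dots> = (M *v axis k 1) \<bullet> (A *v (M *v axis l 1))"
    by (simp only: inner_transpose_mul)
  finally show ?thesis by (simp only: matrix_vector_mult_basis)
qed

lemma symplectic_left_inverse:
  assumes "symplectic M"
  shows "(- (J_matrix ** transpose M ** J_matrix)) ** M = mat 1"
proof -
  have "J_matrix ** (transpose M ** J_matrix ** M) = - mat 1"
    using assms by (simp add: symplectic_def J_matrix_square)
  then show ?thesis by (simp add: matrix_mul_assoc matrix_mul_neg_left)
qed

lemma symplectic_inverse:
  assumes "symplectic M"
  obtains N where "N ** M = mat 1" "M ** N = mat 1"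
  using symplectic_left_inverse[OF assms] matrix_left_right_inverse that by blast

lemma symplectic_mult_inject:
  assumes "symplectic M" "M *v x = M *v y"
  shows "x = y"
  using assms by (metis matrix_vector_mul_assoc matrix_vector_mul_lid symplectic_inverse)

lemma symplectic_inner:
  assumes "symplectic M"
  shows "(M *v x) \<bullet> (J_matrix *v (M *v y)) = x \<bullet> (J_matrix *v y)"
  using assms by (simp add: symplectic_def flip: inner_transpose_mul)

text \<open>A congruence does not preserve the eigenvalues of \<open>A\<close>. As \<open>M\<close>
  preserves the form given by \<open>J\<close>, it acts on \<open>J A\<close> as a similarity, and
  \<open>d\<close> becomes spectral information about \<open>J A\<close>.\<close>

lemma williamson_intertwine:
  assumes "symplectic M" "transpose M ** A ** M = double_diag d"
  shows "J_matrix *v (A *v (M *v x)) = M *v (J_matrix *v (double_diag d *v x))"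
proof -
  define y where "y = J_matrix *v (A *v (M *v x)) - M *v (J_matrix *v (double_diag d *v x))"
  obtain N where N: "M ** N = mat 1" using symplectic_inverse[OF assms(1)] by blast
  have MN: "M *v (N *v w) = w" for w
    by (simp only: matrix_vector_mul_assoc N matrix_vector_mul_lid)
  have "(M *v z) \<bullet> (J_matrix *v y) = 0" for z
  proof -
    have "(M *v z) \<bullet> (A *v (M *v x)) = z \<bullet> (double_diag d *v x)"
      using assms(2) by (simp flip: inner_transpose_mul)
    then show ?thesis
      by (simp add: y_def matrix_vector_mult_diff_distrib inner_diff_right symplectic_inner[OF assms(1)])
  qed
  \<comment> \<open>\<open>M\<close> is onto, so \<open>J y\<close> is itself of the form
    \<open>M z\<close>; being orthogonal to itself, it vanishes.\<close>
  from this[of "N *v (J_matrix *v y)"] have "J_matrix *v y = 0"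
    unfolding MN by simp
  then have "J_matrix *v (J_matrix *v y) = 0" by simp
  then show ?thesis by (simp add: y_def)
qed

lemma J_double_diag_nth:
  "(J_matrix *v (double_diag d *v x)) $ Inl i = d i * x $ Inr i"
  "(J_matrix *v (double_diag d *v x)) $ Inr i = - (d i * x $ Inl i)"
  by (simp_all add: J_matrix_nth double_diag_mult_nth)

text \<open>\<open>J D\<close> has the eigenvalues \<open>\<plusminus> i d\<close>; its square is
  real and diagonal, so that spectra can be compared without leaving the reals.\<close>

lemma J_double_diag_square:
  "(J_matrix *v (double_diag d *v (J_matrix *v (double_diag d *v x)))) $ k
     = - ((case_sum d d k)\<^sup>2 * x $ k)"
  by (cases k) (simp_all add: J_double_diag_nth power2_eq_square)

text \<open>\<open>N\<close> intertwines the squares of \<open>J D\<close> and \<open>J D'\<close>,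
  since both represent the square of \<open>J A\<close>. Hence an entry of \<open>N\<close> can be
  nonzero only where the two eigenvalues agree up to sign.\<close>

lemma williamson_transition_entry:
  assumes M: "symplectic M" "transpose M ** A ** M = double_diag d"
    and M': "symplectic M'" "transpose M' ** A ** M' = double_diag d'"
    and N: "M ** N = M'"
  shows "(case_sum d d k)\<^sup>2 * N $ k $ l = (case_sum d' d' l)\<^sup>2 * N $ k $ l"
proof -
  let ?T = "\<lambda>x. J_matrix *v (A *v x)"
  have M'N: "M' *v y = M *v (N *v y)" for y
    by (simp add: N[symmetric] matrix_vector_mul_assoc)
  let ?x = "axis l 1 :: real^('a + 'a)"
  let ?D = "\<lambda>x. J_matrix *v (double_diag d *v x)"
  let ?D' = "\<lambda>x. J_matrix *v (double_diag d' *v x)"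
  have "M *v ?D (?D (N *v ?x)) = ?T (?T (M *v (N *v ?x)))"
    by (simp only: williamson_intertwine[OF M])
  also have "\<dots> = M *v (N *v ?D' (?D' ?x))"
    by (simp only: williamson_intertwine[OF M'] flip: M'N)
  finally have "?D (?D (N *v ?x)) = N *v ?D' (?D' ?x)"
    by (rule symplectic_mult_inject[OF M(1)])
  moreover have "?D' (?D' ?x) = - ((case_sum d' d' l)\<^sup>2) *\<^sub>R ?x"
    by (simp add: vec_eq_iff J_double_diag_square axis_def)
  ultimately have "?D (?D (N *v ?x)) $ k = (- ((case_sum d' d' l)\<^sup>2) *\<^sub>R (N *v ?x)) $ k"
    by (metis matrix_vector_mult_scaleR)
  then show ?thesis
    by (simp add: J_double_diag_square matrix_vector_mult_basis column_def)
qed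

text \<open>The transition matrix maps the coordinate subspace of the values
  \<open>d' \<le> c\<close> injectively into that of the values \<open>d \<le> c\<close>. Each index
  occupies one \<open>Inl\<close> and one \<open>Inr\<close> coordinate, so the dimensions are twice
  the cardinalities.\<close>

lemma williamson_card_le:
  fixes d d' :: "'n::finite \<Rightarrow> real"
  assumes M: "symplectic M" "transpose M ** A ** M = double_diag d"
    and M': "symplectic M'" "transpose M' ** A ** M' = double_diag d'"
    and pos: "\<And>i. 0 < d i" "\<And>i. 0 < d' i"
  shows "card {i. d' i \<le> c} \<le> card {i. d i \<le> c}"
proof -
  obtain Mi where Mi: "Mi ** M = mat 1" "M ** Mi = mat 1" using symplectic_inverse[OF M(1)] .
  define N where "N = Mi ** M'"
  have MN: "M ** N = M'" by (simp add: N_def matrix_mul_assoc Mi)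
  define K where "K e = {k. case_sum e e k \<le> c}" for e :: "'n \<Rightarrow> real"
  define S where "S e = {x::real^('n+'n). \<forall>k. k \<notin> K e \<longrightarrow> x $ k = 0}" for e
  have cardK: "card (K e) = 2 * card {i. e i \<le> c}" for e
  proof -
    have "k \<in> K e \<longleftrightarrow> k \<in> {i. e i \<le> c} <+> {i. e i \<le> c}" for k
      by (cases k) (auto simp: K_def)
    then have "K e = {i. e i \<le> c} <+> {i. e i \<le> c}" by blast
    then show ?thesis by (simp add: card_Plus)
  qed
  have dimS: "dim (S e) = card (K e)" for e
    unfolding S_def using dim_substandard_cart[of "K e", where 'a=real] by (simp add: dim_vec_eq)
  have subS: "subspace (S e)" for e
    unfolding S_def subspace_def by auto
  have entry: "N $ k $ l = 0" if "l \<in> K d'" "k \<notin> K d" for k l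
  proof (rule ccontr)
    assume "N $ k $ l \<noteq> 0"
    then have "(case_sum d d k)\<^sup>2 = (case_sum d' d' l)\<^sup>2"
      using williamson_transition_entry[OF M M' MN, of k l] by simp
    moreover have "0 < case_sum d d k" "0 < case_sum d' d' l"
      using pos by (simp_all split: sum.split)
    ultimately have "case_sum d d k = case_sum d' d' l" by (simp add: power2_eq_iff)
    then show False using that by (simp add: K_def)
  qed
  have "(\<lambda>x. N *v x) ` S d' \<subseteq> S d"
  proof (clarsimp simp: S_def)
    fix x :: "real^('n+'n)" and k assume x: "\<forall>k. k \<notin> K d' \<longrightarrow> x $ k = 0" and k: "k \<notin> K d"
    show "(N *v x) $ k = 0"
      unfolding matrix_vector_mult_def using x k entry by (auto intro!: sum.neutral) metis
  qed
  then have "dim ((\<lambda>x. N *v x) ` S d') \<le> dim (S d)" by (rule dim_subset)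
  moreover have "inj ((*v) N)"
  proof (rule injI)
    fix x y assume "N *v x = N *v y"
    then have "M' *v x = M' *v y" by (metis MN matrix_vector_mul_assoc)
    then show "x = y" by (rule symplectic_mult_inject[OF M'(1)])
  qed
  then have "dim ((\<lambda>x. N *v x) ` S d') = dim (S d')"
    by (intro dim_image_eq) (auto intro: inj_on_subset)
  ultimately show ?thesis by (simp add: dimS cardK)
qed

text \<open>At the threshold \<open>c = d' i\<close> all indices up to \<open>i\<close> count for
  \<open>d'\<close>, whereas \<open>d' i < d i\<close> would leave only indices strictly below
  \<open>i\<close> for \<open>d\<close>.\<close>

lemma mono_le_of_card_le:
  fixes d d' :: "'n::{finite,linorder} \<Rightarrow> real"
  assumes "mono d" "mono d'" "\<And>c. card {i. d' i \<le> c} \<le> card {i. d i \<le> c}"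
  shows "d i \<le> d' i"
proof (rule ccontr)
  assume "\<not> d i \<le> d' i"
  then have "{k. d k \<le> d' i} \<subseteq> {..<i}"
    using monoD[OF assms(1)] by (force simp: not_le[symmetric])
  then have "{k. d k \<le> d' i} \<subset> {..i}" by auto
  also have "{..i} \<subseteq> {k. d' k \<le> d' i}" using monoD[OF assms(2)] by auto
  finally have "card {k. d k \<le> d' i} < card {k. d' k \<le> d' i}" by (intro psubset_card_mono) auto
  then show False using assms(3)[of "d' i"] by simp
qed

lemma williamson_unique:
  fixes d d' :: "'n::{finite,linorder} \<Rightarrow> real"
  assumes "symplectic M" "transpose M ** A ** M = double_diag d"
    and "symplectic M'" "transpose M' ** A ** M' = double_diag d'"
    and "\<And>i. 0 < d i" "\<And>i. 0 < d' i" "mono d" "mono d'"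
  shows "d = d'"
  using mono_le_of_card_le[OF assms(7,8)] mono_le_of_card_le[OF assms(8,7)]
    williamson_card_le[OF assms(1-6)] williamson_card_le[OF assms(3,4,1,2,6,5)]
  by (intro ext antisym) blast+

section \<open>Existence of a symplectic diagonalisation\<close>

lemma posdef_inner_commute:
  assumes "A \<in> posdef_matrices"
  shows "x \<bullet> (A *v y) = y \<bullet> (A *v x)"
proof -
  have "transpose A = A" using assms by (simp add: posdef_matrices_def symmetric_matrices_def)
  then show ?thesis by (metis dot_lmul_matrix inner_commute vector_transpose_matrix)
qed

lemma posdef_inner_pos: "A \<in> posdef_matrices \<Longrightarrow> x \<noteq> 0 \<Longrightarrow> 0 < x \<bullet> (A *v x)"
  by (simp add: posdef_matrices_def)

text \<open>The first-order condition at a minimum, for a quadratic polynomial in \<open>t\<close>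
  that vanishes at 0.\<close>

lemma nonneg_quadratic_linear_term_zero:
  fixes b c :: real
  assumes "\<And>t. 0 \<le> 2 * t * b + t\<^sup>2 * c"
  shows "b = 0"
proof (rule ccontr)
  assume "b \<noteq> 0"
  have c: "0 \<le> c" using assms[of 1] assms[of "-1"] by simp
  \<comment> \<open>The vertex is at \<open>t = - b / c\<close>; the denominator
    \<open>c + 1\<close> stays positive when \<open>c = 0\<close>.\<close>
  have "2 * (- b / (c + 1)) * b + (- b / (c + 1))\<^sup>2 * c
      \<le> 2 * (- b / (c + 1)) * b + (- b / (c + 1))\<^sup>2 * (c + 1)"
    by (intro add_left_mono mult_left_mono) auto
  also have "\<dots> = - (b\<^sup>2 / (c + 1))"
    using c by (simp add: divide_simps power2_eq_square)
  also have "\<dots> < 0" using c \<open>b \<noteq> 0\<close> by simp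
  finally show False using assms[of "- b / (c + 1)"] by simp
qed

text \<open>The minimiser of the Rayleigh quotient of \<open>-(JA)\<^sup>2\<close> for the inner product
  \<open>x \<bullet> Ay\<close>, with respect to which \<open>JA\<close> is skew.\<close>

lemma eigenvector_pair_in_invariant_subspace:
  fixes A :: "real^('n::finite + 'n)^('n + 'n)"
  assumes A: "A \<in> posdef_matrices" and W: "subspace W" "x1 \<in> W" "x1 \<noteq> 0"
    and inv: "\<And>x. x \<in> W \<Longrightarrow> J_matrix *v (A *v x) \<in> W"
  obtains u v d where "u \<in> W" "v \<in> W" "0 < d" "normalised_symplectic_eigenvector_pair A d u v"
proof -
  define T where "T x = J_matrix *v (A *v x)" for x
  define B where "B x y = x \<bullet> (A *v y)" for x y
  have lin: "linear T" unfolding T_def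
    by (intro linearI) (simp_all add: matrix_vector_right_distrib matrix_vector_mult_scaleR)
  have Bsym: "B x y = B y x" for x y
    unfolding B_def by (rule posdef_inner_commute[OF A])
  have B_add: "B (x + y) z = B x z + B y z" "B z (x + y) = B z x + B z y"
    and B_scale: "B (c *\<^sub>R x) z = c * B x z" "B z (c *\<^sub>R x) = c * B z x" for x y z c
    by (simp_all add: B_def inner_add_left inner_add_right matrix_vector_right_distrib
        matrix_vector_mult_scaleR)
  have Bpos: "0 < B x x" if "x \<noteq> 0" for x
    using that posdef_inner_pos[OF A] by (simp add: B_def)
  have skew: "B (T x) y = - B x (T y)" for x y
  proof -
    have "B (T x) y = - ((A *v x) \<bullet> T y)" by (simp add: B_def T_def inner_J_matrix_left)
    also have "\<dots> = - B x (T y)" by (metis B_def Bsym inner_commute)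
    finally show ?thesis .
  qed
  have cont: "continuous_on X T" "continuous_on X f \<Longrightarrow> continuous_on X (\<lambda>x. A *v f x)" for X f
    using lin by (auto intro: linear_continuous_on bounded_linear.continuous_on
        simp: linear_conv_bounded_linear[symmetric])
  define K where "K = W \<inter> sphere 0 1"
  have cK: "compact K" unfolding K_def using W(1)
    by (simp add: closed_subspace closed_Int_compact)
  have "(1 / norm x1) *\<^sub>R x1 \<in> K"
    using W by (simp add: K_def subspace_scale)
  then have neK: "K \<noteq> {}" by auto
  have "continuous_on K (\<lambda>x. B (T x) (T x) / B x x)"
  proof -
    have "continuous_on K (\<lambda>x. B (T x) (T x))" "continuous_on K (\<lambda>x. B x x)"
      unfolding B_def by (intro continuous_intros cont)+
    moreover have "B x x \<noteq> 0" if "x \<in> K" for x using Bpos[of x] that by (force simp: K_def)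
    ultimately show ?thesis by (intro continuous_on_divide) auto
  qed
  from continuous_attains_inf[OF cK neK this] obtain x where x: "x \<in> K"
    and min: "\<And>y. y \<in> K \<Longrightarrow> B (T x) (T x) / B x x \<le> B (T y) (T y) / B y y"
    by auto
  have xW: "x \<in> W" and x0: "x \<noteq> 0" using x by (auto simp: K_def)
  define m where "m = B (T x) (T x) / B x x"
  \<comment> \<open>\<open>q\<close> is nonnegative on \<open>W\<close> and vanishes at the
    minimiser \<open>x\<close>, so its polar form at \<open>x\<close> vanishes on \<open>W\<close>.
    By skewness of \<open>T\<close> this makes \<open>T (T x) + m x\<close> orthogonal to
    \<open>W\<close> for \<open>B\<close>; as this vector lies in \<open>W\<close>, it is
    zero.\<close>
  define q where "q y = B (T y) (T y) - m * B y y" for y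
  have q0: "q x = 0" using Bpos[OF x0] by (simp add: q_def m_def)
  have qpos: "0 \<le> q y" if "y \<in> W" for y
  proof (cases "y = 0")
    case True
    then show ?thesis using linear_0[OF lin] by (simp add: q_def B_def)
  next
    case False
    define z where "z = (1 / norm y) *\<^sub>R y"
    have "z \<in> K" using False that W(1) by (simp add: z_def K_def subspace_scale)
    then have "m \<le> B (T z) (T z) / B z z" using min by (simp add: m_def)
    also have "\<dots> = B (T y) (T y) / B y y"
      using False by (simp add: z_def linear_scale[OF lin] B_scale)
    finally show ?thesis using Bpos[OF False] by (simp add: q_def field_simps)
  qed
  have TT: "B (T (T x) + m *\<^sub>R x) y = 0" if y: "y \<in> W" for y
  proof -
    have "B (T x) (T y) - m * B x y = 0"
    proof (rule nonneg_quadratic_linear_term_zero)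
      fix t :: real
      have "x + t *\<^sub>R y \<in> W" using W(1) xW y by (simp add: subspace_add subspace_scale)
      then have "0 \<le> q (x + t *\<^sub>R y)" by (rule qpos)
      also have "\<dots> = q x + 2 * t * (B (T x) (T y) - m * B x y) + t\<^sup>2 * q y"
        unfolding q_def linear_add[OF lin] linear_scale[OF lin] B_add B_scale
          Bsym[of "T y" "T x"] Bsym[of y x]
        by (simp add: algebra_simps power2_eq_square)
      finally show "0 \<le> 2 * t * (B (T x) (T y) - m * B x y) + t\<^sup>2 * q y" using q0 by simp
    qed
    then show ?thesis using skew[of "T x" y] by (simp add: B_add B_scale)
  qed
  have "T x \<in> W" "T (T x) \<in> W" using inv xW by (auto simp: T_def)
  then have "T (T x) + m *\<^sub>R x \<in> W" using W(1) xW by (simp add: subspace_add subspace_scale)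
  from TT[OF this] have "T (T x) + m *\<^sub>R x = 0" using Bpos[of "T (T x) + m *\<^sub>R x"] by force
  then have TTx: "T (T x) = - m *\<^sub>R x" by (simp add: eq_neg_iff_add_eq_0)
  have "T x \<noteq> 0"
  proof
    assume "T x = 0"
    then have "J_matrix *v T x = 0" by simp
    then have "A *v x = 0" by (simp add: T_def)
    then show False using Bpos[OF x0] by (simp add: B_def)
  qed
  then have m: "0 < m" using Bpos x0 by (simp add: m_def)
  have "J_matrix *v T (T x) = J_matrix *v (- m *\<^sub>R x)" using TTx by simp
  then have ATx: "A *v T x = m *\<^sub>R (J_matrix *v x)"
    unfolding T_def[of "T x"] by (simp add: matrix_vector_mult_scaleR)
  \<comment> \<open>Since \<open>T (T x) = - m x\<close>, the eigenvalue is \<open>sqrt m\<close>.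
    Below, \<open>v\<close> is chosen to give \<open>A u = d J v\<close>, and \<open>s\<close> makes
    \<open>u \<bullet> J v\<close>, which is \<open>s * s / d * B x x\<close>, equal to 1.\<close>
  define d s where "d = sqrt m" and "s = sqrt (d / B x x)"
  have d: "0 < d" "d * d = m" using m by (auto simp: d_def)
  have s: "s * s = d / B x x" using d Bpos[OF x0] by (simp add: s_def)
  define u v where "u = s *\<^sub>R x" and "v = - (s / d) *\<^sub>R T x"
  have "J_matrix *v v = (s / d) *\<^sub>R (A *v x)"
    by (simp add: v_def T_def matrix_vector_mult_scaleR)
  then have "u \<bullet> (J_matrix *v v) = s * s / d * B x x" and "A *v u = d *\<^sub>R (J_matrix *v v)"
    using d by (simp_all add: u_def B_def matrix_vector_mult_scaleR)
  moreover have "A *v v = - d *\<^sub>R (J_matrix *v u)"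
    using d by (simp add: u_def v_def ATx matrix_vector_mult_scaleR flip: d(2))
  ultimately have "normalised_symplectic_eigenvector_pair A d u v"
    using s d Bpos[OF x0]
    by (simp add: normalised_symplectic_eigenvector_pair_def symplectic_eigenvector_pair_def)
  moreover have "u \<in> W" "v \<in> W" using xW \<open>T x \<in> W\<close> W(1) by (auto simp: u_def v_def subspace_scale subspace_neg)
  ultimately show thesis using that d by blast
qed

text \<open>Symplectic Gram-Schmidt. The complement of the pairs found so far, taken for the form of
  \<open>J\<close>, is invariant under \<open>J A\<close> and nonzero as long as there are fewer
  than \<open>n\<close> pairs. The minimisation yields a further pair inside it, and membership in
  the complement is what the new relations say.\<close>

lemma partial_symplectic_eigenbasis:
  fixes A :: "real^('n::finite + 'n)^('n + 'n)" and S :: "'n set"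
  assumes A: "A \<in> posdef_matrices"
  shows "\<exists>u v d. \<forall>i\<in>S. 0 < d i \<and> symplectic_eigenvector_pair A (d i) (u i) (v i) \<and>
    (\<forall>k\<in>S. u i \<bullet> (J_matrix *v v k) = (if i = k then 1 else 0) \<and>
       u i \<bullet> (J_matrix *v u k) = 0 \<and> v i \<bullet> (J_matrix *v v k) = 0)"
  using finite[of S]
proof (induction S rule: finite_induct)
  case (insert a S)
  then obtain u v d where d: "\<And>i. i \<in> S \<Longrightarrow> 0 < d i"
    and pair: "\<And>i. i \<in> S \<Longrightarrow> symplectic_eigenvector_pair A (d i) (u i) (v i)"
    and J: "\<And>i k. i \<in> S \<Longrightarrow> k \<in> S \<Longrightarrow> u i \<bullet> (J_matrix *v v k) = (if i = k then 1 else 0)"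
      "\<And>i k. i \<in> S \<Longrightarrow> k \<in> S \<Longrightarrow> u i \<bullet> (J_matrix *v u k) = 0"
      "\<And>i k. i \<in> S \<Longrightarrow> k \<in> S \<Longrightarrow> v i \<bullet> (J_matrix *v v k) = 0"
    by blast
  define X where "X = (\<lambda>i. J_matrix *v u i) ` S \<union> (\<lambda>i. J_matrix *v v i) ` S"
  define W where "W = {x. \<forall>y\<in>X. x \<bullet> y = 0}"
  have "dim X \<le> card X" by (intro dim_le_card') (simp add: X_def)
  also have "\<dots> \<le> card S + card S"
    unfolding X_def by (intro order.trans[OF card_Un_le] add_mono card_image_le finite)
  also have "card S < CARD('n)"
    using insert(2) by (intro psubset_card_mono) auto
  then have "card S + card S < DIM(real^('n + 'n))" by simp
  finally obtain x1 where x1: "x1 \<noteq> 0" "\<And>y. y \<in> span X \<Longrightarrow> orthogonal x1 y"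
    using orthogonal_to_subspace_exists by blast
  have W: "x \<in> W \<longleftrightarrow> (\<forall>i\<in>S. x \<bullet> (J_matrix *v u i) = 0 \<and> x \<bullet> (J_matrix *v v i) = 0)" for x
    by (auto simp: W_def X_def)
  have subW: "subspace W" unfolding W_def subspace_def by (auto simp: inner_add_left)
  have x1W: "x1 \<in> W" using x1(2) by (auto simp: W_def orthogonal_def span_base)
  have inv: "J_matrix *v (A *v x) \<in> W" if x: "x \<in> W" for x
    unfolding W
  proof (intro ballI conjI)
    fix i assume i: "i \<in> S"
    \<comment> \<open>\<open>J\<close> is an isometry, and symmetry moves \<open>A\<close> onto
      \<open>u i\<close> or \<open>v i\<close>; there it gives a multiple of \<open>J v i\<close> or
      \<open>J u i\<close>, to which \<open>x\<close> is orthogonal.\<close>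
    have AJ: "(J_matrix *v (A *v x)) \<bullet> (J_matrix *v y) = x \<bullet> (A *v y)" for y
      using posdef_inner_commute[OF A, of y x] by (simp add: inner_J_J inner_commute)
    show "(J_matrix *v (A *v x)) \<bullet> (J_matrix *v u i) = 0"
      "(J_matrix *v (A *v x)) \<bullet> (J_matrix *v v i) = 0"
      using x i pair[OF i] unfolding AJ by (simp_all add: W symplectic_eigenvector_pair_def)
  qed
  obtain u' v' d' where new: "u' \<in> W" "v' \<in> W" "0 < d'"
    "normalised_symplectic_eigenvector_pair A d' u' v'"
    using eigenvector_pair_in_invariant_subspace[OF A subW x1W x1(1) inv] .
  have cross: "u' \<bullet> (J_matrix *v u i) = 0" "u' \<bullet> (J_matrix *v v i) = 0"
    "v' \<bullet> (J_matrix *v u i) = 0" "v' \<bullet> (J_matrix *v v i) = 0"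
    "u i \<bullet> (J_matrix *v u') = 0" "v i \<bullet> (J_matrix *v u') = 0"
    "u i \<bullet> (J_matrix *v v') = 0" "v i \<bullet> (J_matrix *v v') = 0" if "i \<in> S" for i
    using new(1,2) that J_matrix_skew[of "u i" u'] J_matrix_skew[of "v i" u']
      J_matrix_skew[of "u i" v'] J_matrix_skew[of "v i" v'] by (auto simp: W)
  have neq: "i \<noteq> a" if "i \<in> S" for i using that insert(2) by blast
  show ?case
    by (rule exI[of _ "u(a := u')"], rule exI[of _ "v(a := v')"], rule exI[of _ "d(a := d')"])
       (use new(3,4) in \<open>auto simp: normalised_symplectic_eigenvector_pair_def d pair J cross
          dest: neq\<close>)
qed simp

text \<open>Selection sort: the largest index receives a maximiser of \<open>d\<close>. The target
  \<open>T\<close> is kept apart from \<open>S\<close> because each step removes a maximiser from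
  \<open>T\<close> and the largest index from \<open>S\<close>.\<close>

lemma ex_bij_betw_mono_on:
  fixes d :: "'a \<Rightarrow> 'b::linorder" and S :: "'c::linorder set"
  assumes "finite S" "finite T" "card T = card S"
  shows "\<exists>p. bij_betw p S T \<and> mono_on S (d \<circ> p)"
  using assms
proof (induction S arbitrary: T rule: finite_linorder_max_induct)
  case empty
  then show ?case by (auto simp: bij_betw_def mono_on_def)
next
  case (insert b S)
  then have "T \<noteq> {}" by auto
  with insert.prems have "Max (d ` T) \<in> d ` T" by (intro Max_in) auto
  then obtain t where t: "t \<in> T" "d t = Max (d ` T)" by auto
  have "b \<notin> S" using insert by auto
  then have "card (T - {t}) = card S" using t insert by simp
  with insert obtain p where p: "bij_betw p S (T - {t})" "mono_on S (d \<circ> p)" by blast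
  have "bij_betw (p(b := t)) (insert b S) T"
  proof -
    have "bij_betw (p(b := t)) S (T - {t})"
      using p(1) \<open>b \<notin> S\<close> by (subst bij_betw_cong[where g = p]) auto
    then have "bij_betw (p(b := t)) (insert b S) (insert t (T - {t}))"
      using \<open>b \<notin> S\<close> by (intro bij_betw_combine[of _ S _ "{b}" "{t}", simplified]) auto
    then show ?thesis using t by (simp add: insert_absorb)
  qed
  moreover have "mono_on (insert b S) (d \<circ> p(b := t))"
  proof (rule mono_onI)
    fix i k assume ik: "i \<in> insert b S" "k \<in> insert b S" "i \<le> k"
    show "(d \<circ> p(b := t)) i \<le> (d \<circ> p(b := t)) k"
    proof (cases "k = b")
      case True
      have "p(b := t) ` insert b S = T" using calculation by (simp add: bij_betw_def)
      then have "d ((p(b := t)) i) \<in> d ` T" using ik(1) by blast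
      then show ?thesis using True t insert.prems by simp
    next
      case False
      then have "k \<in> S" "i \<noteq> b" using ik insert(2) by auto
      then show ?thesis using ik False mono_onD[OF p(2), of i k] by auto
    qed
  qed
  ultimately show ?case by blast
qed

definition columns_matrix ::
  "('n \<Rightarrow> real^('n + 'n)) \<Rightarrow> ('n \<Rightarrow> real^('n + 'n)) \<Rightarrow> real^('n::finite + 'n)^('n + 'n)" where
  "columns_matrix u v = (\<chi> r c. case c of Inl i \<Rightarrow> u i $ r | Inr i \<Rightarrow> v i $ r)"

lemma column_columns_matrix [simp]:
  "column (Inl i) (columns_matrix u v) = u i" "column (Inr i) (columns_matrix u v) = v i"
  by (simp_all add: column_def columns_matrix_def vec_eq_iff)

lemma williamson:
  fixes A :: "real^('n::{finite,linorder} + 'n)^('n + 'n)"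
  assumes A: "A \<in> posdef_matrices"
  obtains M d where "symplectic M" "transpose M ** A ** M = double_diag d"
    "mono d" "\<And>i. 0 < d i"
proof -
  obtain u v and d :: "'n \<Rightarrow> real" where d: "\<And>i. 0 < d i"
    and pair: "\<And>i. symplectic_eigenvector_pair A (d i) (u i) (v i)"
    and J: "\<And>i k :: 'n. u i \<bullet> (J_matrix *v v k) = (if i = k then 1 else 0)"
      "\<And>i k. u i \<bullet> (J_matrix *v u k) = 0" "\<And>i k. v i \<bullet> (J_matrix *v v k) = 0"
    using partial_symplectic_eigenbasis[OF A, of "UNIV :: 'n set"] unfolding ball_UNIV by blast
  have vJu: "v i \<bullet> (J_matrix *v u k) = (if i = k then -1 else 0)" for i k
    using J(1)[of k i] J_matrix_skew[of "v i" "u k"] by auto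
  obtain p :: "'n \<Rightarrow> 'n" where p: "bij p" "mono (d \<circ> p)"
    using ex_bij_betw_mono_on[of "UNIV :: 'n set" "UNIV :: 'n set" d] by auto
  have p_eq: "p i = p k \<longleftrightarrow> i = k" for i k using p(1) by (auto simp: bij_betw_def inj_eq)
  define M where "M = columns_matrix (u \<circ> p) (v \<circ> p)"
  have "(transpose M ** J_matrix ** M) $ k $ l = J_matrix $ k $ l" for k l
    unfolding transpose_mul_nth M_def
    by (cases k; cases l) (simp_all add: J vJu p_eq J_matrix_entry)
  then have "symplectic M" by (simp add: symplectic_def vec_eq_iff)
  moreover have "(transpose M ** A ** M) $ k $ l = double_diag (d \<circ> p) $ k $ l" for k l
    unfolding transpose_mul_nth M_def
    using pair by (cases k; cases l)
      (auto simp: symplectic_eigenvector_pair_def double_diag_nth J vJu p_eq)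
  then have "transpose M ** A ** M = double_diag (d \<circ> p)" by (simp add: vec_eq_iff)
  ultimately show thesis using that p(2) d by simp
qed

lemma symplectic_eigenvalue_unique:
  assumes "symplectic M" "transpose M ** A ** M = double_diag d" "mono d" "\<And>i. 0 < d i"
  shows "symplectic_eigenvalue A = d"
  unfolding symplectic_eigenvalue_def double_diag_def[symmetric]
  by (rule the_equality) (use assms in \<open>auto intro: williamson_unique\<close>)

lemma symplectic_eigenvalue_williamson:
  assumes "A \<in> posdef_matrices"
  obtains M where "symplectic M" "transpose M ** A ** M = double_diag (symplectic_eigenvalue A)"
    "mono (symplectic_eigenvalue A)" "\<And>i. 0 < symplectic_eigenvalue A i"
proof -
  obtain M d where "symplectic M" "transpose M ** A ** M = double_diag d"
    "mono d" "\<And>i. 0 < d i"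
    using williamson[OF assms] by blast
  moreover from this have "symplectic_eigenvalue A = d" by (rule symplectic_eigenvalue_unique)
  ultimately show thesis using that by simp
qed

lemma symplectic_eigenvalue_pos:
  "A \<in> posdef_matrices \<Longrightarrow> 0 < symplectic_eigenvalue A i"
  using symplectic_eigenvalue_williamson by metis

section \<open>Continuity of the symplectic eigenvalues\<close>

text \<open>The norm of the matrix type is the Frobenius norm, so Cauchy-Schwarz is applied row by
  row.\<close>

lemma norm_matrix_vector_mult_le: "norm (A *v x) \<le> norm A * norm (x :: real^'m)" for A :: "real^'m^'k"
proof -
  have "norm (A *v x) \<le> L2_set (\<lambda>i. norm (A $ i) * norm x) UNIV"
    unfolding norm_vec_def[of "A *v x"] matrix_vector_mul_component
    by (intro L2_set_mono) (auto intro: Cauchy_Schwarz_ineq2)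
  also have "\<dots> = norm A * norm x"
    unfolding norm_vec_def[of A] by (simp add: L2_set_left_distrib)
  finally show ?thesis .
qed

lemma norm_J_matrix [simp]: "norm (J_matrix *v x) = norm x"
  by (simp add: norm_eq_sqrt_inner inner_J_J)

text \<open>As \<open>J\<close> is an isometry, \<open>d > norm A\<close> would give both
  \<open>norm v < norm u\<close> and \<open>norm u < norm v\<close>. The bound serves to control the
  eigenvalues uniformly along a convergent sequence of matrices.\<close>

lemma symplectic_eigenvector_pair_bound:
  assumes "normalised_symplectic_eigenvector_pair A d u v" "0 < d"
  shows "d \<le> norm A"
proof (rule ccontr)
  assume *: "\<not> d \<le> norm A"
  have pair: "A *v u = d *\<^sub>R (J_matrix *v v)" "A *v v = - d *\<^sub>R (J_matrix *v u)"
    "u \<bullet> (J_matrix *v v) = 1"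
    using assms(1) by (simp_all add: normalised_symplectic_eigenvector_pair_def
        symplectic_eigenvector_pair_def)
  have nz: "u \<noteq> 0" "v \<noteq> 0" using pair(3) by auto
  have "d * norm v = norm (A *v u)" "d * norm u = norm (A *v v)"
    unfolding pair using assms(2) by simp_all
  then have "d * norm v \<le> norm A * norm u" "d * norm u \<le> norm A * norm v"
    using norm_matrix_vector_mult_le[of A u] norm_matrix_vector_mult_le[of A v] by auto
  moreover have "norm A * norm u < d * norm u" "norm A * norm v < d * norm v"
    using * nz by auto
  ultimately have "d * norm v < d * norm u" "d * norm u < d * norm v" by auto
  then show False by simp
qed

lemma symplectic_pair_inner:
  assumes "symplectic M"
  shows "column (Inl i) M \<bullet> (J_matrix *v column (Inr i) M) = 1"
  using symplectic_inner[OF assms, of "axis (Inl i) 1" "axis (Inr i) 1"]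
  by (simp add: matrix_vector_mult_basis inner_axis' column_def J_matrix_entry)

text \<open>The equations are the intertwining relation at the basis vectors, where
  \<open>J D\<close> exchanges the coordinates \<open>Inl i\<close> and \<open>Inr i\<close> up to a
  factor \<open>\<plusminus> d i\<close>.\<close>

lemma williamson_columns_pair:
  assumes "symplectic M" "transpose M ** A ** M = double_diag d"
  shows "normalised_symplectic_eigenvector_pair A (d i) (column (Inl i) M) (column (Inr i) M)"
proof -
  have e: "J_matrix *v (double_diag d *v axis (Inl i) 1) = - d i *\<^sub>R axis (Inr i) 1"
    "J_matrix *v (double_diag d *v axis (Inr i) 1) = d i *\<^sub>R axis (Inl i) 1"
    by (auto simp: vec_eq_iff J_double_diag_nth axis_def split_sum_all)
  have "J_matrix *v (A *v column (Inl i) M) = - d i *\<^sub>R column (Inr i) M"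
    "J_matrix *v (A *v column (Inr i) M) = d i *\<^sub>R column (Inl i) M"
    using williamson_intertwine[OF assms, of "axis (Inl i) 1"]
      williamson_intertwine[OF assms, of "axis (Inr i) 1"]
    unfolding e by (simp_all add: matrix_vector_mult_basis matrix_vector_mult_scaleR)
  then have "J_matrix *v (J_matrix *v (A *v column (Inl i) M)) = J_matrix *v (- d i *\<^sub>R column (Inr i) M)"
    "J_matrix *v (J_matrix *v (A *v column (Inr i) M)) = J_matrix *v (d i *\<^sub>R column (Inl i) M)"
    by simp_all
  then have "A *v column (Inl i) M = d i *\<^sub>R (J_matrix *v column (Inr i) M)"
    and *: "d i *\<^sub>R (J_matrix *v column (Inl i) M) = - (A *v column (Inr i) M)"
    by (simp_all add: matrix_vector_mult_scaleR)
  then show ?thesis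
    using symplectic_pair_inner[OF assms(1)]
    by (simp add: normalised_symplectic_eigenvector_pair_def symplectic_eigenvector_pair_def)
qed

lemma symplectic_eigenvalue_le_norm:
  assumes "A \<in> posdef_matrices"
  shows "symplectic_eigenvalue A i \<le> norm A"
proof -
  obtain M where M: "symplectic M" "transpose M ** A ** M = double_diag (symplectic_eigenvalue A)"
    using symplectic_eigenvalue_williamson[OF assms] by blast
  show ?thesis
    using symplectic_eigenvector_pair_bound[OF williamson_columns_pair[OF M]]
      symplectic_eigenvalue_pos[OF assms] by blast
qed

text \<open>\<open>c\<close> is the minimum of \<open>x \<bullet> P x\<close> over the compact
  product of \<open>K\<close> with the unit sphere; homogeneity extends the bound to all
  \<open>x\<close>.\<close>

lemma compact_posdef_coercive:
  fixes K :: "(real^'k^'k) set"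
  assumes "compact K" "K \<subseteq> posdef_matrices"
  obtains c where "0 < c" "\<And>P x. P \<in> K \<Longrightarrow> c * (norm x)\<^sup>2 \<le> x \<bullet> (P *v x)"
proof (cases "K = {}")
  case True
  then show thesis using that[of 1] by simp
next
  case False
  let ?f = "\<lambda>(P, x). x \<bullet> (P *v x)"
  have "compact (K \<times> sphere (0::real^'k) 1)" using assms(1) by (intro compact_Times) auto
  moreover obtain e :: "real^'k" where "e \<in> sphere 0 1"
    using vector_choose_size[of 1] by auto
  then have "K \<times> sphere (0::real^'k) 1 \<noteq> {}" using False by blast
  moreover have "continuous_on (K \<times> sphere (0::real^'k) 1) ?f"
    unfolding case_prod_unfold inner_vec_def matrix_vector_mult_def inner_real_def vec_lambda_beta
    by (intro continuous_intros)
  ultimately obtain p where p: "p \<in> K \<times> sphere 0 1"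
    "\<And>q. q \<in> K \<times> sphere 0 1 \<Longrightarrow> ?f p \<le> ?f q"
    using continuous_attains_inf[of "K \<times> sphere 0 1" ?f] by blast
  have c: "0 < ?f p"
    using p(1) assms(2) by (auto intro!: posdef_inner_pos)
  moreover have "?f p * (norm x)\<^sup>2 \<le> x \<bullet> (P *v x)" if "P \<in> K" for P x
  proof (cases "x = 0")
    case False
    have "?f p \<le> ?f (P, (1 / norm x) *\<^sub>R x)" using False that by (intro p(2)) auto
    then have "?f p \<le> (x \<bullet> (P *v x)) / (norm x)\<^sup>2"
      by (simp add: matrix_vector_mult_scaleR power2_eq_square)
    then show ?thesis using False by (simp add: pos_le_divide_eq)
  qed simp
  ultimately show thesis using that by blast
qed

lemma norm_matrix_le_columns:
  fixes M :: "real^'m^'k"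
  assumes "\<And>j. norm (column j M) \<le> b"
  shows "norm M \<le> real (CARD('k) * CARD('m)) * b"
proof -
  have "norm M \<le> (\<Sum>i\<in>UNIV. norm (M $ i))" unfolding norm_vec_def by (intro L2_set_le_sum) auto
  also have "\<dots> \<le> (\<Sum>i\<in>(UNIV::'k set). \<Sum>j\<in>UNIV. \<bar>M $ i $ j\<bar>)" by (intro sum_mono norm_le_l1_cart)
  also have "\<dots> \<le> (\<Sum>i\<in>(UNIV::'k set). \<Sum>j\<in>(UNIV::'m set). b)"
  proof (intro sum_mono)
    fix i :: 'k and j :: 'm
    show "\<bar>M $ i $ j\<bar> \<le> b"
      using component_le_norm_cart[of "column j M" i] assms[of j] by (simp add: column_def)
  qed
  finally show ?thesis by (simp add: mult.assoc)
qed

lemma tendsto_congruence: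
  fixes M P :: "nat \<Rightarrow> real^'k^'k"
  assumes "M \<longlonglongrightarrow> N" "P \<longlonglongrightarrow> L"
  shows "(\<lambda>n. (transpose (M n) ** P n ** M n) $ k $ l) \<longlonglongrightarrow> (transpose N ** L ** N) $ k $ l"
  unfolding matrix_matrix_mult_def transpose_def vec_lambda_beta
  by (intro tendsto_sum tendsto_mult tendsto_vec_nth assms)

text \<open>The diagonalising matrices stay in a bounded set, and any limit of them diagonalises the
  limit matrix; uniqueness in Williamson's theorem then identifies the limit of the eigenvalues.\<close>

lemma tendsto_symplectic_eigenvalue:
  fixes P :: "nat \<Rightarrow> real^('n::{finite,linorder} + 'n)^('n + 'n)"
  assumes P: "\<And>n. P n \<in> posdef_matrices" and L: "L \<in> posdef_matrices" and lim: "P \<longlonglongrightarrow> L"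
  shows "(\<lambda>n. symplectic_eigenvalue (P n) i) \<longlonglongrightarrow> symplectic_eigenvalue L i"
proof (rule tendstoI, rule ccontr)
  fix e :: real
  assume "0 < e" and nev: "\<not> (\<forall>\<^sub>F n in sequentially.
      dist (symplectic_eigenvalue (P n) i) (symplectic_eigenvalue L i) < e)"
  then obtain r :: "nat \<Rightarrow> nat" where r: "strict_mono r"
    "\<And>n. \<not> dist (symplectic_eigenvalue (P (r n)) i) (symplectic_eigenvalue L i) < e"
    using not_eventually_sequentiallyD[OF nev] by auto
  have "\<forall>n. \<exists>M. symplectic M \<and> transpose M ** P n ** M = double_diag (symplectic_eigenvalue (P n))"
    using symplectic_eigenvalue_williamson[OF P] by metis
  then obtain M where M: "\<And>n. symplectic (M n)"
    "\<And>n. transpose (M n) ** P n ** M n = double_diag (symplectic_eigenvalue (P n))" by metis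
  obtain b where b: "\<And>n. norm (P n) \<le> b"
    using convergent_imp_bounded[OF lim] by (auto simp: bounded_iff)
  obtain c where c: "0 < c" "\<And>n x. c * (norm x)\<^sup>2 \<le> x \<bullet> (P n *v x)"
  proof -
    have "insert L (range P) \<subseteq> posdef_matrices" using P L by auto
    from compact_posdef_coercive[OF compact_sequence_with_limit[OF lim] this]
    show thesis using that by (metis insertI2 rangeI)
  qed
  \<comment> \<open>A column \<open>m\<close> satisfies \<open>m \<bullet> P m = d\<close> for one
    of the eigenvalues \<open>d\<close>, so coercivity bounds its length, although the symplectic
    group itself is not compact.\<close>
  have "norm (column k (M n)) \<le> sqrt (b / c)" for k n
  proof -
    have "c * (norm (column k (M n)))\<^sup>2 \<le> double_diag (symplectic_eigenvalue (P n)) $ k $ k"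
      using c(2)[of "column k (M n)" n] by (simp add: transpose_mul_nth flip: M(2))
    also have "\<dots> \<le> norm (P n)"
      using symplectic_eigenvalue_le_norm[OF P] by (simp add: double_diag_nth split: sum.split)
    also have "\<dots> \<le> b" by (rule b)
    finally show ?thesis using c(1) by (intro real_le_rsqrt) (simp add: field_simps)
  qed
  then have "norm ((M \<circ> r) n) \<le> real (CARD('n + 'n) * CARD('n + 'n)) * sqrt (b / c)" for n
    unfolding o_def by (rule norm_matrix_le_columns)
  then have "bounded (range (M \<circ> r))" unfolding bounded_iff by blast
  then obtain N and s :: "nat \<Rightarrow> nat" where s: "strict_mono s" "((M \<circ> r) \<circ> s) \<longlonglongrightarrow> N"
    using bounded_imp_convergent_subsequence by blast
  define Q where "Q n = P (r (s n))" for n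
  define S where "S n = M (r (s n))" for n
  have S: "symplectic (S n)" "transpose (S n) ** Q n ** S n = double_diag (symplectic_eigenvalue (Q n))" for n
    by (simp_all add: S_def Q_def M)
  have limS: "S \<longlonglongrightarrow> N" using s(2) by (simp add: S_def[abs_def] o_def)
  have "(P \<circ> (r \<circ> s)) \<longlonglongrightarrow> L"
    using lim by (rule LIMSEQ_subseq_LIMSEQ) (intro strict_mono_o r s)
  then have limQ: "Q \<longlonglongrightarrow> L" by (simp add: Q_def[abs_def] o_def)
  have Q: "Q n \<in> posdef_matrices" for n by (simp add: Q_def P)
  have "(transpose N ** J_matrix ** N) $ k $ l = J_matrix $ k $ l" for k l
    using tendsto_congruence[OF limS tendsto_const, of J_matrix k l] S(1)
    by (simp add: symplectic_def LIMSEQ_const_iff)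
  then have N: "symplectic N" by (simp add: symplectic_def vec_eq_iff)
  define d where "d i = (transpose N ** L ** N) $ Inl i $ Inl i" for i
  have entry: "(\<lambda>n. double_diag (symplectic_eigenvalue (Q n)) $ k $ l) \<longlonglongrightarrow> (transpose N ** L ** N) $ k $ l" for k l
    using tendsto_congruence[OF limS limQ, of k l] by (simp add: S(2))
  have limd: "(\<lambda>n. symplectic_eigenvalue (Q n) k) \<longlonglongrightarrow> d k" for k
    using entry[of "Inl k" "Inl k"] by (simp add: double_diag_nth d_def)
  have "(\<lambda>n. double_diag (symplectic_eigenvalue (Q n)) $ k $ l) \<longlonglongrightarrow> double_diag d $ k $ l" for k l
    using limd by (cases k; cases l) (auto simp: double_diag_nth)
  then have "(transpose N ** L ** N) $ k $ l = double_diag d $ k $ l" for k l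
    using entry LIMSEQ_unique by blast
  then have NLN: "transpose N ** L ** N = double_diag d" by (simp add: vec_eq_iff)
  moreover have "mono d"
  proof (rule monoI)
    fix k l :: 'n assume "k \<le> l"
    then have "symplectic_eigenvalue (Q n) k \<le> symplectic_eigenvalue (Q n) l" for n
      using symplectic_eigenvalue_williamson[OF Q] monoD by metis
    then show "d k \<le> d l" using LIMSEQ_le[OF limd limd] by blast
  qed
  \<comment> \<open>Strict inequalities do not pass to limits; positivity comes instead from
    \<open>L\<close> being positive definite and \<open>N\<close> injective.\<close>
  moreover have "0 < d k" for k
  proof -
    have "N *v axis (Inl k) 1 \<noteq> N *v 0"
      using symplectic_mult_inject[OF N, of "axis (Inl k) 1" 0] by (auto simp: axis_eq_0_iff)
    then show ?thesis
      using posdef_inner_pos[OF L, of "column (Inl k) N"]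
      by (simp add: d_def transpose_mul_nth matrix_vector_mult_basis)
  qed
  ultimately have "symplectic_eigenvalue L = d" by (rule symplectic_eigenvalue_unique[OF N])
  then have "\<forall>\<^sub>F n in sequentially. dist (symplectic_eigenvalue (Q n) i) (symplectic_eigenvalue L i) < e"
    using limd tendstoD \<open>0 < e\<close> by metis
  then show False using r(2) by (simp add: Q_def eventually_sequentially)
qed

lemma continuous_on_symplectic_eigenvalue:
  "continuous_on posdef_matrices (\<lambda>P. symplectic_eigenvalue P i)"
  unfolding continuous_on_sequentially o_def
  by (auto intro: tendsto_symplectic_eigenvalue)

section \<open>Simple symplectic eigenvalues\<close>

lemma simple_symplectic_eigenvalue_iff:
  "simple_symplectic_eigenvalue P (symplectic_eigenvalue P j) \<longleftrightarrow>
     (\<forall>i. i \<noteq> j \<longrightarrow> symplectic_eigenvalue P i \<noteq> symplectic_eigenvalue P j)"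
proof -
  let ?S = "{i. symplectic_eigenvalue P i = symplectic_eigenvalue P j}"
  have "j \<in> ?S" by simp
  then have "card ?S = 1 \<longleftrightarrow> ?S = {j}"
    by (metis card_1_singletonE is_singletonI is_singleton_altdef singletonD)
  then show ?thesis
    unfolding simple_symplectic_eigenvalue_def symplectic_multiplicity_def by auto
qed

lemma normalised_symplectic_eigenvector_pairD:
  assumes "normalised_symplectic_eigenvector_pair A d u v"
  shows "symplectic_eigenvector_pair A d u v" "A *v u = d *\<^sub>R (J_matrix *v v)"
    "A *v v = - d *\<^sub>R (J_matrix *v u)" "u \<bullet> (J_matrix *v v) = 1" "v \<bullet> (J_matrix *v u) = -1"
  using assms J_matrix_skew[of v u]
  by (simp_all add: normalised_symplectic_eigenvector_pair_def symplectic_eigenvector_pair_def)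

lemma symplectic_eigenvector_pair_rotate:
  assumes "symplectic_eigenvector_pair A d u v"
  shows "symplectic_eigenvector_pair A d (a *\<^sub>R u - b *\<^sub>R v) (b *\<^sub>R u + a *\<^sub>R v)"
  using assms
  by (simp add: symplectic_eigenvector_pair_def matrix_vector_right_distrib matrix_vector_mult_diff_distrib
      matrix_vector_mult_scaleR algebra_simps)

lemma rotate_inner_J:
  assumes "u \<bullet> (J_matrix *v v) = 1"
  shows "(a *\<^sub>R u - b *\<^sub>R v) \<bullet> (J_matrix *v (b *\<^sub>R u + a *\<^sub>R v)) = a\<^sup>2 + b\<^sup>2"
  using assms J_matrix_skew[of v u]
  by (simp add: matrix_vector_right_distrib matrix_vector_mult_scaleR inner_add_right inner_diff_left
      power2_eq_square)

text \<open>In the coordinates \<open>p\<close>, \<open>q\<close> of \<open>x\<close>,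
  \<open>y\<close> with respect to the columns of \<open>M\<close> the equations decouple over the
  indices \<open>i\<close> and force the squares of \<open>d i\<close> and \<open>d j\<close> to
  agree wherever a coordinate is nonzero. Simplicity leaves only \<open>i = j\<close>, where two
  real parameters remain free.\<close>

lemma simple_eigenvector_pair_rotation_ex:
  fixes P :: "real^('n::{finite,linorder} + 'n)^('n + 'n)"
  assumes P: "P \<in> posdef_matrices"
    and simple: "simple_symplectic_eigenvalue P (symplectic_eigenvalue P j)"
  obtains u v where "normalised_symplectic_eigenvector_pair P (symplectic_eigenvalue P j) u v"
    "\<And>x y. symplectic_eigenvector_pair P (symplectic_eigenvalue P j) x y \<Longrightarrow>
       \<exists>a b. x = a *\<^sub>R u - b *\<^sub>R v \<and> y = b *\<^sub>R u + a *\<^sub>R v"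
proof -
  let ?d = "symplectic_eigenvalue P"
  obtain M where M: "symplectic M" "transpose M ** P ** M = double_diag ?d"
    using symplectic_eigenvalue_williamson[OF P] by blast
  obtain N where N: "M ** N = mat 1" using symplectic_inverse[OF M(1)] by blast
  have MN: "M *v (N *v w) = w" for w
    by (simp only: matrix_vector_mul_assoc N matrix_vector_mul_lid)
  have pos: "0 < ?d i" for i by (rule symplectic_eigenvalue_pos[OF P])
  let ?u = "column (Inl j) M" and ?v = "column (Inr j) M"
  have "\<exists>a b. x = a *\<^sub>R ?u - b *\<^sub>R ?v \<and> y = b *\<^sub>R ?u + a *\<^sub>R ?v"
    if pair: "symplectic_eigenvector_pair P (?d j) x y" for x y
  proof -
    define p q where "p = N *v x" and "q = N *v y"
    have xy: "x = M *v p" "y = M *v q" by (simp_all add: p_def q_def MN)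
    have "M *v (J_matrix *v (double_diag ?d *v p)) = M *v (- ?d j *\<^sub>R q)"
      "M *v (J_matrix *v (double_diag ?d *v q)) = M *v (?d j *\<^sub>R p)"
      using pair
      by (simp_all add: symplectic_eigenvector_pair_def matrix_vector_mult_scaleR
          flip: williamson_intertwine[OF M] xy)
    then have "J_matrix *v (double_diag ?d *v p) = - ?d j *\<^sub>R q"
      "J_matrix *v (double_diag ?d *v q) = ?d j *\<^sub>R p"
      using symplectic_mult_inject[OF M(1)] by blast+
    then have "(J_matrix *v (double_diag ?d *v p)) $ k = - ?d j * q $ k"
      "(J_matrix *v (double_diag ?d *v q)) $ k = ?d j * p $ k" for k by simp_all
    from this[of "Inl _"] this[of "Inr _"]
    have "?d i * p $ Inr i = - ?d j * q $ Inl i" "?d i * p $ Inl i = ?d j * q $ Inr i"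
      "?d i * q $ Inr i = ?d j * p $ Inl i" "- (?d i * q $ Inl i) = ?d j * p $ Inr i" for i
      by (simp_all add: J_double_diag_nth)
    note eqs = this
    have eq4: "?d i * q $ Inl i = - (?d j * p $ Inr i)" for i using eqs(4)[of i] by linarith
    have "?d j * (q $ Inl j + p $ Inr j) = 0" using eq4[of j] by (simp add: distrib_left)
    then have at_j: "q $ Inl j = - p $ Inr j" "q $ Inr j = p $ Inl j"
      using eqs(2)[of j] pos[of j] by (auto simp: eq_neg_iff_add_eq_0)
    have off: "p $ Inl i = 0 \<and> p $ Inr i = 0 \<and> q $ Inl i = 0 \<and> q $ Inr i = 0" if "i \<noteq> j" for i
    proof -
      have "(?d i)\<^sup>2 \<noteq> (?d j)\<^sup>2"
        using simple that pos[of i] pos[of j]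
        by (auto simp: simple_symplectic_eigenvalue_iff power2_eq_iff)
      moreover have "(?d i)\<^sup>2 * p $ Inl i = (?d j)\<^sup>2 * p $ Inl i"
        using eqs(2,3)[of i] by algebra
      moreover have "(?d i)\<^sup>2 * p $ Inr i = (?d j)\<^sup>2 * p $ Inr i"
        using eqs(1,4)[of i] by algebra
      ultimately have "p $ Inl i = 0" "p $ Inr i = 0" by auto
      then show ?thesis using eqs(3)[of i] eq4[of i] pos[of i] pos[of j] by auto
    qed
    have "p = p $ Inl j *\<^sub>R axis (Inl j) 1 + p $ Inr j *\<^sub>R axis (Inr j) 1"
      "q = - p $ Inr j *\<^sub>R axis (Inl j) 1 + p $ Inl j *\<^sub>R axis (Inr j) 1"
      using off at_j by (auto simp: vec_eq_iff split_sum_all axis_def)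
    then have "x = M *v (p $ Inl j *\<^sub>R axis (Inl j) 1 + p $ Inr j *\<^sub>R axis (Inr j) 1)"
      "y = M *v (- p $ Inr j *\<^sub>R axis (Inl j) 1 + p $ Inl j *\<^sub>R axis (Inr j) 1)"
      using xy by simp_all
    then have "x = p $ Inl j *\<^sub>R ?u - (- p $ Inr j) *\<^sub>R ?v"
      "y = (- p $ Inr j) *\<^sub>R ?u + p $ Inl j *\<^sub>R ?v"
      by (simp_all add: matrix_vector_right_distrib matrix_vector_mult_diff_distrib
          matrix_vector_mult_scaleR matrix_vector_mult_basis)
    then show ?thesis by blast
  qed
  with williamson_columns_pair[OF M] show thesis using that by blast
qed

lemma simple_eigenvector_pair_rotation:
  fixes P :: "real^('n::{finite,linorder} + 'n)^('n + 'n)"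
  assumes P: "P \<in> posdef_matrices"
    and simple: "simple_symplectic_eigenvalue P (symplectic_eigenvalue P j)"
    and uv: "normalised_symplectic_eigenvector_pair P (symplectic_eigenvalue P j) u v"
    and xy: "symplectic_eigenvector_pair P (symplectic_eigenvalue P j) x y"
  shows "\<exists>a b. x = a *\<^sub>R u - b *\<^sub>R v \<and> y = b *\<^sub>R u + a *\<^sub>R v"
proof -
  obtain U V where UV: "normalised_symplectic_eigenvector_pair P (symplectic_eigenvalue P j) U V"
    "\<And>x y. symplectic_eigenvector_pair P (symplectic_eigenvalue P j) x y \<Longrightarrow>
       \<exists>a b. x = a *\<^sub>R U - b *\<^sub>R V \<and> y = b *\<^sub>R U + a *\<^sub>R V"
    using simple_eigenvector_pair_rotation_ex[OF P simple] by blast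
  obtain c e where ce: "u = c *\<^sub>R U - e *\<^sub>R V" "v = e *\<^sub>R U + c *\<^sub>R V"
    using UV(2) normalised_symplectic_eigenvector_pairD(1)[OF uv] by blast
  obtain a b where ab: "x = a *\<^sub>R U - b *\<^sub>R V" "y = b *\<^sub>R U + a *\<^sub>R V"
    using UV(2) xy by blast
  have 1: "c\<^sup>2 + e\<^sup>2 = 1"
    using rotate_inner_J[OF normalised_symplectic_eigenvector_pairD(4)[OF UV(1)], of c e]
      normalised_symplectic_eigenvector_pairD(4)[OF uv] by (simp add: ce)
  \<comment> \<open>As \<open>c + ie\<close> has modulus one, the factor taking
    \<open>u + iv\<close> to \<open>x + iy\<close> is \<open>(a + ib)(c - ie)\<close>, with real
    part \<open>a c + b e\<close> and imaginary part \<open>b c - a e\<close>.\<close>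
  have a: "a = (a * c + b * e) * c - (b * c - a * e) * e" and b: "b = (a * c + b * e) * e + (b * c - a * e) * c"
    using 1 by algebra+
  have "x = (a * c + b * e) *\<^sub>R u - (b * c - a * e) *\<^sub>R v"
    unfolding ab(1) ce by (subst a, subst b) (simp add: algebra_simps)
  moreover have "y = (b * c - a * e) *\<^sub>R u + (a * c + b * e) *\<^sub>R v"
    unfolding ab(2) ce by (subst a, subst b) (simp add: algebra_simps)
  ultimately show ?thesis by blast
qed

section \<open>One invertible linear system for both vectors of an eigenvector pair\<close>

definition pair_vec :: "real^'k \<Rightarrow> real^'k \<Rightarrow> real^('k::finite + 'k)" where
  "pair_vec x y = (\<chi> k. case k of Inl i \<Rightarrow> x $ i | Inr i \<Rightarrow> y $ i)"

definition fst_vec :: "real^('k + 'k) \<Rightarrow> real^'k::finite" where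
  "fst_vec z = (\<chi> i. z $ Inl i)"

definition snd_vec :: "real^('k + 'k) \<Rightarrow> real^'k::finite" where
  "snd_vec z = (\<chi> i. z $ Inr i)"

lemma pair_vec_nth [simp]: "pair_vec x y $ Inl i = x $ i" "pair_vec x y $ Inr i = y $ i"
  by (simp_all add: pair_vec_def)

lemma fst_snd_pair_vec [simp]:
  "fst_vec (pair_vec x y) = x" "snd_vec (pair_vec x y) = y" "pair_vec (fst_vec z) (snd_vec z) = z"
  by (simp_all add: fst_vec_def snd_vec_def vec_eq_iff split_sum_all)

lemma pair_vec_eq_0_iff: "pair_vec x y = 0 \<longleftrightarrow> x = 0 \<and> y = 0"
  by (simp add: vec_eq_iff split_sum_all)

lemma inner_pair_vec: "pair_vec x y \<bullet> pair_vec x' y' = x \<bullet> x' + y \<bullet> y'"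
  by (simp add: inner_vec_def sum_UNIV_Plus)

lemma block_matrix_mult_pair_vec:
  "block_matrix A B C D *v pair_vec x y = pair_vec (A *v x + B *v y) (C *v x + D *v y)"
  by (simp add: vec_eq_iff split_sum_all matrix_vector_mult_def sum_UNIV_Plus block_matrix_def)

text \<open>The pair \<open>(x, y)\<close> is an eigenvector pair iff it lies in the kernel of
  \<open>block_matrix P (- d J) (d J) P\<close>. For a simple eigenvalue this kernel is a plane, and adding
  two squares of linear forms makes the operator invertible. The two forms are (up to sign)
  the imaginary and real parts of \<open>w0* J w\<close> for \<open>w = x + \<i> y\<close>, so requiring the second to vanish
  is exactly the phase condition.\<close>

definition phase_vec :: "real^('n + 'n) \<Rightarrow> real^('n + 'n) \<Rightarrow> real^(('n::finite + 'n) + ('n + 'n))" where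
  "phase_vec u v = pair_vec (J_matrix *v v) (- (J_matrix *v u))"

definition outer_square :: "real^'k \<Rightarrow> real^'k^'k" where
  "outer_square k = (\<chi> i j. k $ i * k $ j)"

definition bordered_operator :: "real^('n + 'n) \<Rightarrow> real^('n + 'n) \<Rightarrow> real \<Rightarrow> real^('n + 'n)^('n + 'n) \<Rightarrow>
    real^(('n::finite + 'n) + ('n + 'n))^(('n + 'n) + ('n + 'n))" where
  "bordered_operator u v d P = block_matrix P (- d *\<^sub>R J_matrix) (d *\<^sub>R J_matrix) P +
     outer_square (phase_vec u v) + outer_square (phase_vec v (- u))"

lemma outer_square_mult: "outer_square k *v z = (k \<bullet> z) *\<^sub>R k"
  by (simp add: outer_square_def matrix_vector_mult_def vec_eq_iff inner_vec_def sum_distrib_left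
      mult_ac)

lemma inner_phase_vec:
  "phase_vec u v \<bullet> pair_vec x y = u \<bullet> (J_matrix *v y) - v \<bullet> (J_matrix *v x)"
  by (simp add: phase_vec_def inner_pair_vec inner_J_matrix_left)

lemma bordered_operator_mult:
  "bordered_operator u v d P *v pair_vec x y =
     pair_vec (P *v x - d *\<^sub>R (J_matrix *v y)) (P *v y + d *\<^sub>R (J_matrix *v x)) +
     (phase_vec u v \<bullet> pair_vec x y) *\<^sub>R phase_vec u v +
     (phase_vec v (- u) \<bullet> pair_vec x y) *\<^sub>R phase_vec v (- u)"
  unfolding bordered_operator_def
  by (simp add: matrix_vector_mult_add_rdistrib block_matrix_mult_pair_vec outer_square_mult add.commute
      flip: scaleR_matrix_vector_assoc)

lemma bordered_operator_mult_pair: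
  assumes "symplectic_eigenvector_pair P d x y"
  shows "bordered_operator u v d P *v pair_vec x y =
     (phase_vec u v \<bullet> pair_vec x y) *\<^sub>R phase_vec u v +
     (phase_vec v (- u) \<bullet> pair_vec x y) *\<^sub>R phase_vec v (- u)"
proof -
  have "pair_vec (P *v x - d *\<^sub>R (J_matrix *v y)) (P *v y + d *\<^sub>R (J_matrix *v x)) = 0"
    using assms by (simp add: symplectic_eigenvector_pair_def pair_vec_eq_0_iff)
  then show ?thesis by (simp add: bordered_operator_mult)
qed

text \<open>The block part is symmetric, so its image is orthogonal to its kernel, which contains
  \<open>(u, v)\<close> and \<open>(-v, u)\<close>. Pairing \<open>L z = 0\<close> with these two
  vectors isolates the two linear forms, which therefore vanish at \<open>z\<close>. Then
  \<open>z\<close> is in the kernel of the block part, where the forms read off the rotation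
  coefficients as \<open>2 a\<close> and \<open>- 2 b\<close>.\<close>

lemma bordered_operator_det_nonzero:
  fixes A :: "real^('n::{finite,linorder} + 'n)^('n + 'n)"
  assumes A: "A \<in> posdef_matrices"
    and simple: "simple_symplectic_eigenvalue A (symplectic_eigenvalue A j)"
    and uv: "normalised_symplectic_eigenvector_pair A (symplectic_eigenvalue A j) u v"
  shows "det (bordered_operator u v (symplectic_eigenvalue A j) A) \<noteq> 0"
proof -
  let ?d = "symplectic_eigenvalue A j"
  let ?L = "bordered_operator u v ?d A"
  note uvD = normalised_symplectic_eigenvector_pairD[OF uv]
  have "z = 0" if Lz: "?L *v z = 0" for z
  proof -
    define x y where "x = fst_vec z" and "y = snd_vec z"
    have z: "z = pair_vec x y" by (simp add: x_def y_def)
    let ?G = "pair_vec (A *v x - ?d *\<^sub>R (J_matrix *v y)) (A *v y + ?d *\<^sub>R (J_matrix *v x))"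
    have sym: "pair_vec p q \<bullet> ?G = 0" if "symplectic_eigenvector_pair A ?d p q" for p q
    proof -
      have "p \<bullet> (A *v x) = x \<bullet> (A *v p)" "q \<bullet> (A *v y) = y \<bullet> (A *v q)"
        by (rule posdef_inner_commute[OF A])+
      then show ?thesis
        using that J_matrix_skew[of x q] J_matrix_skew[of y p]
        by (simp add: inner_pair_vec symplectic_eigenvector_pair_def inner_diff_right inner_add_right)
    qed
    have rot: "symplectic_eigenvector_pair A ?d (- v) u"
      using symplectic_eigenvector_pair_rotate[OF uvD(1), of 0 1] by simp
    have "pair_vec u v \<bullet> (?L *v z) = 2 * (phase_vec u v \<bullet> z)"
      "pair_vec (- v) u \<bullet> (?L *v z) = - (2 * (phase_vec v (- u) \<bullet> z))"
      unfolding z bordered_operator_mult inner_add_right sym[OF uvD(1)] sym[OF rot]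
      using inner_phase_vec[of u v u v] inner_phase_vec[of v "- u" u v]
        inner_phase_vec[of u v "- v" u] inner_phase_vec[of v "- u" "- v" u]
      by (simp_all add: uvD(4,5) inner_commute[of "pair_vec _ _" "phase_vec _ _"])
    then have phase: "phase_vec u v \<bullet> z = 0" "phase_vec v (- u) \<bullet> z = 0"
      unfolding Lz by simp_all
    then have "?G = 0" using Lz unfolding z bordered_operator_mult by simp
    then have "symplectic_eigenvector_pair A ?d x y"
      by (simp add: pair_vec_eq_0_iff symplectic_eigenvector_pair_def eq_neg_iff_add_eq_0)
    then obtain a b where ab: "x = a *\<^sub>R u - b *\<^sub>R v" "y = b *\<^sub>R u + a *\<^sub>R v"
      using simple_eigenvector_pair_rotation[OF A simple uv] by blast
    have "phase_vec u v \<bullet> z = 2 * a" "phase_vec v (- u) \<bullet> z = - (2 * b)"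
      unfolding z inner_phase_vec ab
      by (simp_all add: matrix_vector_right_distrib matrix_vector_mult_diff_distrib
          matrix_vector_mult_scaleR inner_add_right inner_diff_right uvD(4,5))
    then show ?thesis using phase by (simp add: z ab pair_vec_eq_0_iff)
  qed
  then have "\<exists>B. B ** ?L = mat 1" by (simp add: matrix_left_invertible_ker)
  then show ?thesis by (metis invertible_det_nz invertible_left_inverse)
qed

text \<open>Invertibility alone does not make the solution an eigenvector pair. A pair
  \<open>(U, V)\<close> of \<open>P\<close> has form values \<open>s\<close>, \<open>t\<close> that
  are not both zero, as it would otherwise lie in the kernel. Rotated and scaled to the form values
  1 and 0, it solves the system, hence is the solution.\<close>

lemma bordered_operator_solution:
  fixes P :: "real^('n::{finite,linorder} + 'n)^('n + 'n)"
  assumes P: "P \<in> posdef_matrices"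
    and det: "det (bordered_operator u0 v0 (symplectic_eigenvalue P j) P) \<noteq> 0"
  defines "z \<equiv> cramer_solution (bordered_operator u0 v0 (symplectic_eigenvalue P j) P) (phase_vec u0 v0)"
  shows "symplectic_eigenvector_pair P (symplectic_eigenvalue P j) (fst_vec z) (snd_vec z)"
    and "0 < fst_vec z \<bullet> (J_matrix *v snd_vec z)"
    and "u0 \<bullet> (J_matrix *v fst_vec z) + v0 \<bullet> (J_matrix *v snd_vec z) = 0"
proof -
  let ?d = "symplectic_eigenvalue P j"
  let ?L = "bordered_operator u0 v0 ?d P"
  obtain M where M: "symplectic M" "transpose M ** P ** M = double_diag (symplectic_eigenvalue P)"
    using symplectic_eigenvalue_williamson[OF P] by blast
  define U V where "U = column (Inl j) M" and "V = column (Inr j) M"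
  have UV: "normalised_symplectic_eigenvector_pair P ?d U V"
    unfolding U_def V_def by (rule williamson_columns_pair[OF M])
  note UVD = normalised_symplectic_eigenvector_pairD[OF UV]
  define s where "s = phase_vec u0 v0 \<bullet> pair_vec U V"
  define t where "t = u0 \<bullet> (J_matrix *v U) + v0 \<bullet> (J_matrix *v V)"
  have k2: "phase_vec v0 (- u0) \<bullet> pair_vec U V = t"
    by (simp add: t_def inner_phase_vec)
  define r where "r = s\<^sup>2 + t\<^sup>2"
  have "r \<noteq> 0"
  proof
    assume "r = 0"
    then have "s = 0" "t = 0" by (auto simp: r_def sum_power2_eq_zero_iff)
    then have "?L *v pair_vec U V = 0"
      using k2 by (simp add: bordered_operator_mult_pair[OF UVD(1)] s_def)
    moreover have "?L *v 0 = 0" by simp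
    ultimately have "pair_vec U V = 0" using cramer_solution_iff[OF det] by metis
    then show False using UVD(4) by (simp add: pair_vec_eq_0_iff)
  qed
  then have r: "0 < r" by (simp add: r_def sum_power2_gt_zero_iff)
  \<comment> \<open>The complex pairing of the two pairs is \<open>s - it\<close>, and
    \<open>a + ib\<close> is its inverse.\<close>
  define a b where "a = s / r" and "b = t / r"
  have ab: "a * s + b * t = 1" "a * t - b * s = 0"
    using r by (simp_all add: a_def b_def flip: add_divide_distrib)
      (simp_all add: r_def power2_eq_square)
  define x y where "x = a *\<^sub>R U - b *\<^sub>R V" and "y = b *\<^sub>R U + a *\<^sub>R V"
  have pair: "symplectic_eigenvector_pair P ?d x y"
    unfolding x_def y_def by (rule symplectic_eigenvector_pair_rotate[OF UVD(1)])
  have "phase_vec u0 v0 \<bullet> pair_vec x y = a * s + b * t"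
    "phase_vec v0 (- u0) \<bullet> pair_vec x y = a * t - b * s"
    unfolding s_def t_def x_def y_def inner_phase_vec
    by (simp_all add: matrix_vector_right_distrib matrix_vector_mult_diff_distrib
        matrix_vector_mult_scaleR inner_add_right inner_diff_right algebra_simps)
  then have k: "phase_vec u0 v0 \<bullet> pair_vec x y = 1" "phase_vec v0 (- u0) \<bullet> pair_vec x y = 0"
    by (simp_all add: ab)
  then have "?L *v pair_vec x y = phase_vec u0 v0"
    by (simp add: bordered_operator_mult_pair[OF pair])
  then have z: "z = pair_vec x y" unfolding z_def using cramer_solution_iff[OF det] by metis
  show "symplectic_eigenvector_pair P ?d (fst_vec z) (snd_vec z)" using pair by (simp add: z)
  show "u0 \<bullet> (J_matrix *v fst_vec z) + v0 \<bullet> (J_matrix *v snd_vec z) = 0"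
    using k(2) by (simp add: z inner_phase_vec)
  have "x \<bullet> (J_matrix *v y) = a\<^sup>2 + b\<^sup>2"
    unfolding x_def y_def by (rule rotate_inner_J[OF UVD(4)])
  moreover have "a \<noteq> 0 \<or> b \<noteq> 0" using ab(1) by auto
  ultimately show "0 < fst_vec z \<bullet> (J_matrix *v snd_vec z)"
    by (simp add: z sum_power2_gt_zero_iff)
qed

section \<open>Smooth dependence of the eigenvalue and its eigenvectors on the matrix\<close>

lemma Ck_on_bordered_operator:
  assumes "Ck_on V k U d"
  shows "Ck_on V k U (\<lambda>P. bordered_operator u v (d P) P $ r $ c)"
proof -
  have entry: "Ck_on V k U (\<lambda>P. P $ i $ l)" for i l
    using Ck_on_component[OF Ck_on_component[OF Ck_on_bounded_linear[OF bounded_linear_ident]]] .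
  have "Ck_on V k U (\<lambda>P. block_matrix P (- d P *\<^sub>R J_matrix) (d P *\<^sub>R J_matrix) P $ r $ c)"
  proof (cases r; cases c)
    fix i l assume "r = Inl i" "c = Inr l"
    then show ?thesis
      using Ck_on_mult[OF assms Ck_on_const[of V k U "- (J_matrix $ i $ l)"]]
      by (simp add: block_matrix_def)
  next
    fix i l assume "r = Inr i" "c = Inl l"
    then show ?thesis
      using Ck_on_mult[OF assms Ck_on_const[of V k U "J_matrix $ i $ l"]]
      by (simp add: block_matrix_def)
  qed (simp_all add: block_matrix_def entry)
  then show ?thesis
    unfolding bordered_operator_def vector_add_component by (intro Ck_on_add Ck_on_const)
qed

text \<open>Exact difference formula: the derivative of the eigenvalue follows from continuity of the
  eigenvectors alone.\<close>

lemma symplectic_eigenvalue_difference: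
  assumes P: "normalised_symplectic_eigenvector_pair P d u v" and Pp: "P \<in> posdef_matrices"
    and Q: "normalised_symplectic_eigenvector_pair Q e p q" and Qp: "Q \<in> posdef_matrices"
  shows "(d - e) * (p \<bullet> (J_matrix *v v) - q \<bullet> (J_matrix *v u)) =
    (\<chi> i k. p $ i * u $ k + q $ i * v $ k) \<bullet> (P - Q)"
proof -
  note PD = normalised_symplectic_eigenvector_pairD[OF P]
  note QD = normalised_symplectic_eigenvector_pairD[OF Q]
  have "(\<chi> i k. p $ i * u $ k + q $ i * v $ k) \<bullet> R = p \<bullet> (R *v u) + q \<bullet> (R *v v)" for R
    by (simp add: inner_vec_def matrix_vector_mult_def sum_distrib_left sum.distrib algebra_simps)
  then have "(\<chi> i k. p $ i * u $ k + q $ i * v $ k) \<bullet> (P - Q) =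
      p \<bullet> (P *v u) + q \<bullet> (P *v v) - (p \<bullet> (Q *v u) + q \<bullet> (Q *v v))"
    by (simp add: inner_diff_right)
  \<comment> \<open>Symmetry of \<open>Q\<close> moves it onto its own eigenvectors
    \<open>p\<close>, \<open>q\<close>; both halves then become multiples, by \<open>d\<close> and
    by \<open>e\<close>, of the same pairing of the two pairs.\<close>
  also have "p \<bullet> (Q *v u) + q \<bullet> (Q *v v) = u \<bullet> (Q *v p) + v \<bullet> (Q *v q)"
    using posdef_inner_commute[OF Qp] by metis
  finally show ?thesis
    using J_matrix_skew[of u q] J_matrix_skew[of v p]
    by (simp add: PD QD algebra_simps)
qed

lemma simple_symplectic_eigenvalue_smooth_on:
  fixes A :: "real^('n::{finite,linorder} + 'n)^('n + 'n)" and j :: 'n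
  assumes A: "A \<in> posdef_matrices"
    and simple: "simple_symplectic_eigenvalue A (symplectic_eigenvalue A j)"
    and uv0: "normalised_symplectic_eigenvector_pair A (symplectic_eigenvalue A j) u0 v0"
  obtains U u v where "openin (top_of_set posdef_matrices) U" "A \<in> U"
    "\<And>P. P \<in> U \<Longrightarrow> simple_symplectic_eigenvalue P (symplectic_eigenvalue P j)"
    "smooth_on symmetric_matrices U (\<lambda>P. symplectic_eigenvalue P j)"
    "smooth_on symmetric_matrices U u" "smooth_on symmetric_matrices U v"
    "\<And>P. P \<in> U \<Longrightarrow> normalised_symplectic_eigenvector_pair P (symplectic_eigenvalue P j) (u P) (v P)"
    "u A = u0" "v A = v0"
    "\<And>P. P \<in> U \<Longrightarrow> u0 \<bullet> (J_matrix *v u P) + v0 \<bullet> (J_matrix *v v P) = 0"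
proof -
  define d where "d P = symplectic_eigenvalue P j" for P :: "real^('n + 'n)^('n + 'n)"
  define L where "L P = bordered_operator u0 v0 (d P) P" for P
  \<comment> \<open>One continuous function whose zeros among the positive definite matrices are
    those to be excluded: either the bordered operator is singular, or another eigenvalue coincides
    with the one at \<open>j\<close>.\<close>
  define F where "F P = det (L P) * (\<Prod>i\<in>-{j}. symplectic_eigenvalue P i - d P)" for P
  define U where "U = posdef_matrices \<inter> F -` (- {0})"
  define z where "z P = cramer_solution (L P) (phase_vec u0 v0)" for P
  define n where "n P = sqrt (fst_vec (z P) \<bullet> (J_matrix *v snd_vec (z P)))" for P
  define u v where "u P = (1 / n P) *\<^sub>R fst_vec (z P)" and "v P = (1 / n P) *\<^sub>R snd_vec (z P)" for P
  have U: "P \<in> U \<longleftrightarrow> P \<in> posdef_matrices \<and> det (L P) \<noteq> 0 \<and> simple_symplectic_eigenvalue P (d P)" for P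
    unfolding U_def F_def d_def simple_symplectic_eigenvalue_iff by auto
  have contd: "continuous_on posdef_matrices d"
    unfolding d_def[abs_def] by (rule continuous_on_symplectic_eigenvalue)
  have "Ck_on UNIV 0 posdef_matrices (\<lambda>P. det (L P))"
    unfolding L_def by (intro Ck_on_det Ck_on_bordered_operator) (simp add: contd)
  then have "continuous_on posdef_matrices F"
    unfolding F_def by (intro continuous_intros contd continuous_on_symplectic_eigenvalue) simp
  then have openU: "openin (top_of_set posdef_matrices) U"
    unfolding U_def by (rule continuous_openin_preimage_gen) auto
  have AU: "A \<in> U"
    using A simple bordered_operator_det_nonzero[OF A simple uv0] by (simp add: U L_def d_def)
  have sol: "symplectic_eigenvector_pair P (d P) (fst_vec (z P)) (snd_vec (z P))"
    "0 < fst_vec (z P) \<bullet> (J_matrix *v snd_vec (z P))"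
    "u0 \<bullet> (J_matrix *v fst_vec (z P)) + v0 \<bullet> (J_matrix *v snd_vec (z P)) = 0" if "P \<in> U" for P
    using bordered_operator_solution[of P u0 v0 j] that unfolding U z_def L_def d_def by auto
  have n: "0 < n P" if "P \<in> U" for P using sol(2)[OF that] by (simp add: n_def)
  have norm: "normalised_symplectic_eigenvector_pair P (d P) (u P) (v P)" if "P \<in> U" for P
  proof -
    have "n P * n P = fst_vec (z P) \<bullet> (J_matrix *v snd_vec (z P))"
      using sol(2)[OF that] by (simp add: n_def)
    then show ?thesis
      using sol(1,2)[OF that] n[OF that]
      by (simp add: normalised_symplectic_eigenvector_pair_def symplectic_eigenvector_pair_def u_def v_def
          matrix_vector_mult_scaleR divide_simps)
  qed
  have phase: "u0 \<bullet> (J_matrix *v u P) + v0 \<bullet> (J_matrix *v v P) = 0" if "P \<in> U" for P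
    using sol(3)[OF that]
    by (simp add: u_def v_def matrix_vector_mult_scaleR flip: add_divide_distrib)
  \<comment> \<open>On \<open>(u0, v0)\<close> the two forms take the values 2 and 0, while the
    system asks for 1 and 0. Its solution at \<open>A\<close> is thus half the pair, and division by
    \<open>n A = 1/2\<close> restores it.\<close>
  have at_A: "u A = u0" "v A = v0"
  proof -
    note D = normalised_symplectic_eigenvector_pairD[OF uv0]
    have "phase_vec u0 v0 \<bullet> pair_vec u0 v0 = 2" "phase_vec v0 (- u0) \<bullet> pair_vec u0 v0 = 0"
      by (simp_all add: inner_phase_vec D(4,5))
    then have "L A *v pair_vec u0 v0 = 2 *\<^sub>R phase_vec u0 v0"
      unfolding L_def d_def bordered_operator_mult_pair[OF D(1)] by simp
    then have "L A *v ((1/2) *\<^sub>R pair_vec u0 v0) = phase_vec u0 v0"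
      by (simp add: matrix_vector_mult_scaleR)
    moreover have "det (L A) \<noteq> 0" using AU by (simp add: U)
    ultimately have "z A = (1/2) *\<^sub>R pair_vec u0 v0"
      by (simp add: z_def cramer_solution_iff)
    then have z: "z A = pair_vec ((1/2) *\<^sub>R u0) ((1/2) *\<^sub>R v0)"
      by (simp add: vec_eq_iff split_sum_all)
    have "n A = sqrt ((1/2)\<^sup>2)"
      unfolding n_def z by (simp add: matrix_vector_mult_scaleR D(4) power2_eq_square)
    then have "n A = 1/2" by simp
    then show "u A = u0" "v A = v0" by (simp_all add: u_def v_def z)
  qed
  have Ck_uv: "Ck_on V k U u" "Ck_on V k U v" if "Ck_on V k U d" for V k
  proof -
    have Cz: "Ck_on V k U z"
      unfolding z_def[abs_def] L_def using that U
      by (intro Ck_on_cramer_solution Ck_on_bordered_operator) (auto simp: L_def)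
    have Cf: "Ck_on V k U (\<lambda>P. fst_vec (z P))" "Ck_on V k U (\<lambda>P. snd_vec (z P))"
      by (rule Ck_on_vec, simp add: fst_vec_def snd_vec_def Ck_on_component[OF Cz])+
    have "Ck_on V k U n"
      unfolding n_def[abs_def] using sol(2)
      by (intro Ck_on_sqrt Ck_on_inner Cf
          Ck_on_bounded_linear_compose[OF matrix_vector_mul_bounded_linear])
    then have Cn: "Ck_on V k U (\<lambda>P. 1 / n P)"
      using n by (intro Ck_on_divide Ck_on_const) force+
    show "Ck_on V k U u"
      unfolding u_def[abs_def]
      by (rule Ck_on_vec) (simp only: vector_scaleR_component real_scaleR_def
          Ck_on_mult[OF Cn Ck_on_component[OF Cf(1)]])
    show "Ck_on V k U v"
      unfolding v_def[abs_def]
      by (rule Ck_on_vec) (simp only: vector_scaleR_component real_scaleR_def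
          Ck_on_mult[OF Cn Ck_on_component[OF Cf(2)]])
  qed
  \<comment> \<open>The matrix representing
    \<open>h \<mapsto> (u \<bullet> h u + v \<bullet> h v) / 2\<close> as an inner product with
    \<open>h\<close>.\<close>
  define g :: "_ \<Rightarrow> real^('n + 'n)^('n + 'n)"
    where "g P = (\<chi> i k. (u P $ i * u P $ k + v P $ i * v P $ k) / 2)" for P
  have contU: "continuous_on U d" using contd by (rule continuous_on_subset) (simp add: U_def)
  have deriv: "(d has_derivative (\<lambda>h. g Q \<bullet> h)) (at Q within U)" if Q: "Q \<in> U" for Q
  proof -
    \<comment> \<open>The difference formula divided by \<open>s\<close> makes \<open>f P\<close> a
      slope between the fixed \<open>Q\<close> and \<open>P\<close>. At \<open>P = Q\<close> the
      divisor is 2 and the slope is \<open>g Q\<close>.\<close>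
    define s where "s P = u Q \<bullet> (J_matrix *v v P) - v Q \<bullet> (J_matrix *v u P)" for P
    define f :: "_ \<Rightarrow> real^('n + 'n)^('n + 'n)"
      where "f P = (\<chi> i k. (u Q $ i * u P $ k + v Q $ i * v P $ k) / s P)" for P
    \<comment> \<open>Continuity of \<open>d\<close> is order zero of the calculus, and Cramer's
      rule passes it on to the eigenvectors.\<close>
    have "continuous_on U u" "continuous_on U v"
      using Ck_uv[of UNIV 0] contU by simp_all
    then have lim: "(u \<longlongrightarrow> u Q) (at Q within U)" "(v \<longlongrightarrow> v Q) (at Q within U)"
      using Q by (auto simp: continuous_on_def)
    have sQ: "s Q = 2"
      using normalised_symplectic_eigenvector_pairD(4,5)[OF norm[OF Q]] by (simp add: s_def)
    have "(s \<longlongrightarrow> s Q) (at Q within U)"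
      unfolding s_def[abs_def]
      by (intro tendsto_intros lim bounded_linear.tendsto[OF matrix_vector_mul_bounded_linear])
    then have lims: "(s \<longlongrightarrow> 2) (at Q within U)" by (simp add: sQ)
    have "(f \<longlongrightarrow> f Q) (at Q within U)"
      unfolding f_def[abs_def] sQ
      by (intro vec_tendstoI) (simp add: tendsto_intros lim lims)
    moreover have "f Q = g Q" by (simp add: f_def g_def sQ)
    moreover have "\<forall>\<^sub>F P in at Q within U. d P - d Q = f P \<bullet> (P - Q)"
    proof -
      have "\<forall>\<^sub>F P in at Q within U. 0 < s P" using order_tendstoD(1)[OF lims, of 0] by simp
      moreover have "\<forall>\<^sub>F P in at Q within U. P \<in> U" by (simp add: eventually_at_filter)
      ultimately show ?thesis
      proof eventually_elim
        case (elim P)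
        have "f P = (1 / s P) *\<^sub>R (\<chi> i k. u Q $ i * u P $ k + v Q $ i * v P $ k)"
          by (simp add: f_def vec_eq_iff)
        moreover have "(d P - d Q) * s P = (\<chi> i k. u Q $ i * u P $ k + v Q $ i * v P $ k) \<bullet> (P - Q)"
          using symplectic_eigenvalue_difference[OF norm[OF elim(2)] _ norm[OF Q]] elim(2) Q
          by (simp add: s_def U)
        ultimately show ?case using elim(1) by (simp add: field_simps)
      qed
    qed
    ultimately show ?thesis using has_derivative_slope_factor[of d Q f U] by simp
  qed
  have Ckd: "Ck_on V k U d" for V k
  proof (induction k)
    case (Suc k)
    have "Ck_on V k U g"
      unfolding g_def[abs_def]
      by (rule Ck_on_vec, simp only: vec_lambda_beta, rule Ck_on_vec)
        (simp add: Ck_on_divide Ck_on_const Ck_on_add Ck_on_mult Ck_on_component Ck_uv[OF Suc])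
    then have "Ck_on V k U (\<lambda>P. g P \<bullet> h)" for h
      by (rule Ck_on_bounded_linear_compose[OF bounded_linear_inner_left])
    then show ?case using deriv by (auto intro!: exI[of _ "\<lambda>P h. g P \<bullet> h"])
  qed (simp add: contU)
  show thesis
  proof (rule that[OF openU AU])
    show "smooth_on symmetric_matrices U (\<lambda>P. symplectic_eigenvalue P j)"
      using Ckd unfolding smooth_on_def d_def[abs_def] by blast
    show "smooth_on symmetric_matrices U u" "smooth_on symmetric_matrices U v"
      using Ck_uv[OF Ckd] by (auto simp: smooth_on_def)
  qed (use U norm phase at_A in \<open>auto simp: d_def\<close>)
qed

theorem theorem3p3:
  fixes A :: "real^('n + 'n)^('n::{finite,linorder} + 'n)" and j :: 'n
  assumes "A \<in> posdef_matrices"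
    and "simple_symplectic_eigenvalue A (symplectic_eigenvalue A j)"
  shows "\<exists>U. openin (top_of_set posdef_matrices) U \<and> A \<in> U \<and>
    (\<forall>P\<in>U. simple_symplectic_eigenvalue P (symplectic_eigenvalue P j)) \<and>
    smooth_on symmetric_matrices U (\<lambda>P. symplectic_eigenvalue P j) \<and>
    (\<forall>u0 v0. normalised_symplectic_eigenvector_pair A (symplectic_eigenvalue A j) u0 v0 \<longrightarrow>
      (\<exists>u v :: real^('n + 'n)^('n + 'n) \<Rightarrow> real^('n + 'n).
        smooth_on symmetric_matrices U u \<and> smooth_on symmetric_matrices U v \<and>
        (\<forall>P\<in>U. normalised_symplectic_eigenvector_pair P (symplectic_eigenvalue P j) (u P) (v P)) \<and>
        u A = u0 \<and> v A = v0 \<and>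
        (\<forall>P\<in>U. u0 \<bullet> (J_matrix *v u P) + v0 \<bullet> (J_matrix *v v P) = 0)))"
proof -
  let ?d = "\<lambda>P. symplectic_eigenvalue P j"
  \<comment> \<open>\<open>U\<close> has to be fixed before a pair \<open>(u0, v0)\<close> is given,
    so it is built from a reference pair.\<close>
  obtain p q where pq: "normalised_symplectic_eigenvector_pair A (?d A) p q"
    by (rule simple_eigenvector_pair_rotation_ex[OF assms]) (rule that)
  show ?thesis
  proof (rule simple_symplectic_eigenvalue_smooth_on[OF assms pq])
    fix U u v
    assume U: "openin (top_of_set posdef_matrices) U" "A \<in> U"
      "\<And>P. P \<in> U \<Longrightarrow> simple_symplectic_eigenvalue P (?d P)"
      "smooth_on symmetric_matrices U ?d"
      and smooth: "smooth_on symmetric_matrices U u" "smooth_on symmetric_matrices U v"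
      and pair: "\<And>P. P \<in> U \<Longrightarrow> normalised_symplectic_eigenvector_pair P (?d P) (u P) (v P)"
      and at_A: "u A = p" "v A = q"
      and phase: "\<And>P. P \<in> U \<Longrightarrow> p \<bullet> (J_matrix *v u P) + q \<bullet> (J_matrix *v v P) = 0"
    have ex: "\<exists>u v. smooth_on symmetric_matrices U u \<and> smooth_on symmetric_matrices U v \<and>
        (\<forall>P\<in>U. normalised_symplectic_eigenvector_pair P (?d P) (u P) (v P)) \<and> u A = u0 \<and> v A = v0 \<and>
        (\<forall>P\<in>U. u0 \<bullet> (J_matrix *v u P) + v0 \<bullet> (J_matrix *v v P) = 0)"
      if uv0: "normalised_symplectic_eigenvector_pair A (?d A) u0 v0" for u0 v0
    proof -
      obtain a b where ab: "u0 = a *\<^sub>R p - b *\<^sub>R q" "v0 = b *\<^sub>R p + a *\<^sub>R q"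
        using simple_eigenvector_pair_rotation[OF assms pq]
          normalised_symplectic_eigenvector_pairD(1)[OF uv0] by blast
      have rot: "a\<^sup>2 + b\<^sup>2 = 1"
        using rotate_inner_J[OF normalised_symplectic_eigenvector_pairD(4)[OF pq], of a b]
          normalised_symplectic_eigenvector_pairD(4)[OF uv0] by (simp add: ab)
      define u' v' where "u' P = a *\<^sub>R u P - b *\<^sub>R v P" and "v' P = b *\<^sub>R u P + a *\<^sub>R v P" for P
      have lin: "smooth_on symmetric_matrices U (\<lambda>P. c *\<^sub>R u P + e *\<^sub>R v P)" for c e
        using smooth unfolding smooth_on_def
        by (auto intro!: Ck_on_add Ck_on_bounded_linear_compose[OF bounded_linear_scaleR_right])
      have "smooth_on symmetric_matrices U u'" "smooth_on symmetric_matrices U v'"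
        using lin[of a "- b"] lin[of b a] by (simp_all add: u'_def[abs_def] v'_def[abs_def])
      moreover have "normalised_symplectic_eigenvector_pair P (?d P) (u' P) (v' P)" if "P \<in> U" for P
        using symplectic_eigenvector_pair_rotate[of P "?d P" "u P" "v P" a b] rot
          rotate_inner_J[of "u P" "v P" a b] pair[OF that]
        unfolding normalised_symplectic_eigenvector_pair_def u'_def v'_def by simp
      moreover have "u0 \<bullet> (J_matrix *v u' P) + v0 \<bullet> (J_matrix *v v' P) = 0" if "P \<in> U" for P
      proof -
        \<comment> \<open>The pair at \<open>A\<close> and the pair at \<open>P\<close> are both
          multiplied by \<open>a + ib\<close>, so their sesquilinear pairing only gains the squared
          modulus as a factor.\<close>
        have "u0 \<bullet> (J_matrix *v u' P) + v0 \<bullet> (J_matrix *v v' P) =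
            (a\<^sup>2 + b\<^sup>2) * (p \<bullet> (J_matrix *v u P) + q \<bullet> (J_matrix *v v P))"
          unfolding ab u'_def v'_def
          by (simp add: matrix_vector_right_distrib matrix_vector_mult_diff_distrib
              matrix_vector_mult_scaleR inner_add_left inner_add_right inner_diff_left inner_diff_right
              algebra_simps power2_eq_square)
        then show ?thesis using phase[OF that] by simp
      qed
      moreover have "u' A = u0" "v' A = v0" by (simp_all add: u'_def v'_def ab at_A)
      ultimately have "smooth_on symmetric_matrices U u' \<and> smooth_on symmetric_matrices U v' \<and>
          (\<forall>P\<in>U. normalised_symplectic_eigenvector_pair P (?d P) (u' P) (v' P)) \<and> u' A = u0 \<and> v' A = v0 \<and>
          (\<forall>P\<in>U. u0 \<bullet> (J_matrix *v u' P) + v0 \<bullet> (J_matrix *v v' P) = 0)"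
        by simp
      then show ?thesis by (intro exI)
    qed
    show ?thesis by (intro exI[of _ U] conjI ballI allI impI U ex)
  qed
qed

end
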